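(* Let $N=(N_1,N_2)$ be a stationary bivariate point process on $\mathbb{R}^d$ and let $X=(X_1,X_2)$, $X_i=\bigcup_{x\in N_i}B(x,r)$, be the associated germ-grain model for balls of radius $r>0$. Write, for $x\in\mathbb{R}^d$ and $t_1,t_2\in\mathbb{R}^+$, $$F_N(t_1,t_2;x)=\mathbb{P}(d(0,N_1)\le t_1;\,d(x,N_2)\le t_2)$$ for the joint empty space function of $N$ at lag $x$ and let $F_{N_i}(t)=\mathbb{P}(d(0,N_i)\le t)$ be the marginal empty space function of $N_i$, $i=1,2$. If $F_{N_i}(r)>0$ for $i=1,2$, then the random coverage measure $\Psi=(\ell(X_1\cap\cdot),\ell(X_2\cap\cdot))$ of $X$ is coverage-reweighted moment stationary with, for $t\ge0$, $$K_{12}(t)=\frac1{F_{N_1}(r)\,F_{N_2}(r)}\int_{B(0,t)}F_N(r,r;x)\,dx$$ and, for $t>0$, $$\lim_{s\to\infty}J_{12;sX}(st)=\frac{F_{N_1}(r)-F_N(r,r+t;0)}{F_{N_1}(r)\,(1-F_{N_2}(r+t))}$$ whenever $F_{N_1}(r)>0$ and $F_{N_2}(r+t)<1$.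
   Context: $\ell$ is Lebesgue measure on $\mathbb{R}^d$; $B(a,t)$ is the closed ball of radius $t\ge0$ centred at $a$; $d(x,A)$ is the Euclidean distance from $x$ to $A$ ($=\infty$ if $A=\emptyset$). Point processes are locally finite; stationary means that the joint distribution of $(N_1,N_2)$ is invariant under common translations. A subscript $sX$ means that the statistic is evaluated for the coverage measure of the scaled random closed set $sX=(sX_1,sX_2)$, $sX_i=\{sx:x\in X_i\}$, $s>0$. Random measures. A bivariate random measure $\Psi=(\Psi_1,\Psi_2)$ on $\mathbb{R}^d$ is a measurable map from a probability space into the locally finite Borel measures on $\mathbb{R}^d\times\{1,2\}$; $\Psi_i(B)$ is the mass of $B\times\{i\}$. Its $k$-th order moment measure is $\mu^{(k)}((B_1\times\{i_1\})\times\cdots\times(B_k\times\{i_k\}))=\mathbb{E}(\Psi_{i_1}(B_1)\cdots\Psi_{i_k}(B_k))$, assumed locally finite. If it equals $\int_{B_1}\cdots\int_{B_k}p_k((x_1,i_1),\dots,(x_k,i_k))\,dx_1\cdots dx_k$, then $p_k$ is the $k$-point coverage function; for the coverage measure of a random closed set we use the version $p_k((x_1,i_1),\dots,(x_k,i_k))=\mathbb{P}(x_1\in X_{i_1};\dots;x_k\in X_{i_k})$. Cumulant densities. If all $p_k$ exist and $p_1>0$, define recursively $\xi_1\equiv1$ and, for $k\ge2$, $$\frac{p_k((x_1,i_1),\dots,(x_k,i_k))}{p_1(x_1,i_1)\cdots p_1(x_k,i_k)}=\sum_{m=1}^k\sum_{D_1,\dots,D_m}\prod_{j=1}^m\xi_{|D_j|}(\{(x_l,i_l):l\in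 D_j\}),$$ the inner sum being over all partitions of $\{1,\dots,k\}$ into $m$ non-empty sets. $\Psi$ is coverage-reweighted moment stationary if moment measures of all orders exist and are absolutely continuous, $\inf p_1(x,i)>0$, and every $\xi_k$ is translation invariant: $\xi_k((x_1+a,i_1),\dots,(x_k+a,i_k))=\xi_k((x_1,i_1),\dots,(x_k,i_k))$ for all $a$, all labels and almost all $x_j$. Cross $K$-function: $K_{12}(t)=\int_{B(0,t)}(1+\xi_2((0,1),(x,2)))\,dx$. Palm distributions. $P^{(x,i)}$, with expectation $\mathbb{E}^{(x,i)}$, is determined, uniquely up to a $\mu^{(1)}$-null set, by $\mathbb{E}[\sum_i\int g((x,i),\Psi)\,d\Psi_i(x)]=\sum_i\int\mathbb{E}^{(x,i)}[g((x,i),\Psi)]\,d\mu^{(1)}(x,i)$ for all non-negative measurable $g$. The Laplace functional is $L(u)=\mathbb{E}\exp[-\sum_i\int u(x,i)\,d\Psi_i(x)]$, and $L^{(a,1)}$ is the Laplace functional of $\Psi$ under $P^{(a,1)}$. Cross $J$-function. It is given by $J_{12}(t)=1+\sum_{k\ge1}\frac{(-1)^k}{k!}\int_{B(0,t)}\cdots\int_{B(0,t)}\xi_{k+1}((0,1),(x_1,2),\dots,(x_k,2))\,dx_1\cdots dx_k$ when absolutely convergent. Here it is used in its Laplace-functional form $J_{12}(t)=L^{(a,1)}(u_t^a)/L(u_t^a)$ with $u_t^a(x,i)=1\{(x,i)\in B(a,t)\times\{2\}\}/p_1(x,i)$, which agrees with the series when the series for $J_{12}(t)$ and the moment expansion of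 $L(u_t^a)$ are absolutely convergent. By stationarity the ratio takes the same value for almost all $a\in\mathbb{R}^d$, and $J_{12}(t)$ denotes this value. *)

theory Defs
  imports "HOL-Probability.Probability"
begin

text \<open>
  \<open>\<real>\<^sup>d\<close> is a type \<open>'a :: euclidean_space\<close>. The labels are the elements \<open>1\<close> and \<open>2\<close> (\<open>= 0\<close>) of the
  two-element type \<open>2\<close>. A measure on \<open>\<real>\<^sup>d \<times> {1,2}\<close> is given by its two components, as a function
  \<open>\<psi> :: 2 \<Rightarrow> 'a measure\<close> in which \<open>\<psi> i\<close> maps \<open>B\<close> to the mass of \<open>B \<times> {i}\<close>.
\<close>

section \<open>Random measures and point processes\<close>

definition locally_finite_measure :: "'a::euclidean_space measure \<Rightarrow> bool" where
  "locally_finite_measure m \<longleftrightarrow>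
     sets m = sets borel \<and> (\<forall>B\<in>sets borel. bounded B \<longrightarrow> emeasure m B < \<infinity>)"

definition bivariate_measures :: "(2 \<Rightarrow> 'a::euclidean_space measure) measure" where
  "bivariate_measures =
     (SUP (i, B) \<in> UNIV \<times> sets borel.
        vimage_algebra {\<psi>. \<forall>i. locally_finite_measure (\<psi> i)} (\<lambda>\<psi>. emeasure (\<psi> i) B) borel)"

definition random_measure :: "'w measure \<Rightarrow> ('w \<Rightarrow> 2 \<Rightarrow> 'a::euclidean_space measure) \<Rightarrow> bool" where
  "random_measure M \<Psi> \<longleftrightarrow> \<Psi> \<in> M \<rightarrow>\<^sub>M bivariate_measures"

text \<open>Multiplicities are allowed, and the two components may share points.\<close>

definition point_process :: "'w measure \<Rightarrow> ('w \<Rightarrow> 2 \<Rightarrow> 'a::euclidean_space measure) \<Rightarrow> bool" where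
  "point_process M N \<longleftrightarrow> random_measure M N \<and>
     (\<forall>\<omega>\<in>space M. \<forall>i. \<forall>B\<in>sets borel. bounded B \<longrightarrow> emeasure (N \<omega> i) B \<in> \<nat>)"

definition points :: "'a::euclidean_space measure \<Rightarrow> 'a set" where
  "points m = {x. emeasure m {x} \<noteq> 0}"

definition translate :: "'a::euclidean_space \<Rightarrow> (2 \<Rightarrow> 'a measure) \<Rightarrow> 2 \<Rightarrow> 'a measure" where
  "translate a \<psi> i = distr (\<psi> i) borel (\<lambda>x. x + a)"

definition stationary :: "'w measure \<Rightarrow> ('w \<Rightarrow> 2 \<Rightarrow> 'a::euclidean_space measure) \<Rightarrow> bool" where
  "stationary M \<Psi> \<longleftrightarrow>
     (\<forall>a. distr M bivariate_measures (\<lambda>\<omega>. translate a (\<Psi> \<omega>)) = distr M bivariate_measures \<Psi>)"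

section \<open>Moment measures and coverage functions\<close>

text \<open>The value of the \<open>k\<close>-th order moment measure on
  \<open>(B 0 \<times> {i 0}) \<times> \<dots> \<times> (B (k - 1) \<times> {i (k - 1)})\<close>; these values determine it.\<close>

definition moment ::
  "'w measure \<Rightarrow> ('w \<Rightarrow> 2 \<Rightarrow> 'a::euclidean_space measure) \<Rightarrow> nat \<Rightarrow> (nat \<Rightarrow> 'a set) \<Rightarrow> (nat \<Rightarrow> 2) \<Rightarrow> ennreal"
where
  "moment M \<Psi> k B i = (\<integral>\<^sup>+\<omega>. (\<Prod>j<k. emeasure (\<Psi> \<omega> (i j)) (B j)) \<partial>M)"

definition moments_locally_finite ::
  "'w measure \<Rightarrow> ('w \<Rightarrow> 2 \<Rightarrow> 'a::euclidean_space measure) \<Rightarrow> bool" where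
  "moments_locally_finite M \<Psi> \<longleftrightarrow>
     (\<forall>k\<ge>1. \<forall>B i. (\<forall>j<k. B j \<in> sets borel \<and> bounded (B j)) \<longrightarrow> moment M \<Psi> k B i < \<infinity>)"

text \<open>A family \<open>(p\<^sub>k)\<close> of functions of \<open>k\<close> labelled points is one function on lists, \<open>p\<^sub>k\<close> being its
  restriction to lists of length \<open>k\<close>.\<close>

definition labelled :: "nat \<Rightarrow> (nat \<Rightarrow> 'a) \<Rightarrow> (nat \<Rightarrow> 2) \<Rightarrow> ('a \<times> 2) list" where
  "labelled k x i = map (\<lambda>j. (x j, i j)) [0..<k]"

definition coverage_functions ::
  "'w measure \<Rightarrow> ('w \<Rightarrow> 2 \<Rightarrow> 'a::euclidean_space measure) \<Rightarrow> (('a \<times> 2) list \<Rightarrow> real) \<Rightarrow> bool" where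
  "coverage_functions M \<Psi> p \<longleftrightarrow> (\<forall>zs. 0 \<le> p zs) \<and>
     (\<forall>k\<ge>1. \<forall>i.
        (\<lambda>x. p (labelled k x i)) \<in> borel_measurable (\<Pi>\<^sub>M j\<in>{..<k}. lborel) \<and>
        (\<forall>B. (\<forall>j<k. B j \<in> sets borel) \<longrightarrow>
           moment M \<Psi> k B i =
             (\<integral>\<^sup>+x\<in>(\<Pi>\<^sub>E j\<in>{..<k}. B j). ennreal (p (labelled k x i)) \<partial>(\<Pi>\<^sub>M j\<in>{..<k}. lborel))))"

section \<open>Cumulant densities\<close>

text \<open>The defining relation, solved for the term of the one-block partition; see
  \<open>cumulant_expansion\<close> below.\<close>

function cumulant :: "(('a \<times> 2) list \<Rightarrow> real) \<Rightarrow> ('a \<times> 2) list \<Rightarrow> real" where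
  "cumulant p zs =
     (if length zs \<le> 1 then 1
      else p zs / (\<Prod>z\<leftarrow>zs. p [z]) -
        (\<Sum>P\<in>{P. partition_on {..<length zs} P \<and> P \<noteq> {{..<length zs}}}. \<Prod>D\<in>P. cumulant p (nths zs D)))"
  by pat_completeness auto

lemma nths_partition_shorter:
  assumes "partition_on {..<length zs} P" "P \<noteq> {{..<length zs}}" "D \<in> P"
  shows "length (nths zs D) < length zs"
proof -
  have sub: "D \<subseteq> {..<length zs}"
    using assms(1,3) by (auto simp: partition_on_def)
  have "D \<noteq> {..<length zs}"
  proof
    assume D: "D = {..<length zs}"
    have "E = D" if E: "E \<in> P" for E
    proof (rule ccontr)
      assume "E \<noteq> D"
      then have "E \<inter> D = {}"
        using partition_onD2[OF assms(1)] E assms(3) by (auto dest: disjointD)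
      moreover have "E \<subseteq> D" using partition_onD1[OF assms(1)] E D by auto
      moreover have "E \<noteq> {}" using partition_onD3[OF assms(1)] E by metis
      ultimately show False by blast
    qed
    then have "P = {D}" using assms(3) by blast
    with assms(2) D show False by simp
  qed
  with sub have "card D < card {..<length zs}"
    by (intro psubset_card_mono) auto
  moreover have "{i. i < length zs \<and> i \<in> D} = D" using sub by auto
  ultimately show ?thesis by (simp add: length_nths)
qed

termination cumulant
  by (relation "Wellfounded.measure (\<lambda>(p, zs). length zs)") (auto intro: nths_partition_shorter)

declare cumulant.simps [simp del]

lemma cumulant_expansion:
  assumes "2 \<le> length zs"
  shows "p zs / (\<Prod>z\<leftarrow>zs. p [z]) =
    (\<Sum>P | partition_on {..<length zs} P. \<Prod>D\<in>P. cumulant p (nths zs D))"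
proof -
  let ?k = "length zs"
  have "0 \<in> {..<?k}" using assms by (cases zs) simp_all
  then have ne: "{..<?k} \<noteq> {}" by blast
  have part: "partition_on {..<?k} {{..<?k}}"
    using ne by (rule partition_on_space)
  have fin: "finite {P. partition_on {..<?k} P}"
    by (rule finitely_many_partition_on) simp
  have nths: "nths zs {..<?k} = zs"
    by (simp add: nths_all)
  have eq: "{P. partition_on {..<?k} P} - {{{..<?k}}} = {P. partition_on {..<?k} P \<and> P \<noteq> {{..<?k}}}"
    by auto
  have "(\<Sum>P | partition_on {..<?k} P. \<Prod>D\<in>P. cumulant p (nths zs D)) =
    cumulant p zs + (\<Sum>P\<in>{P. partition_on {..<?k} P \<and> P \<noteq> {{..<?k}}}. \<Prod>D\<in>P. cumulant p (nths zs D))"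
    using sum.remove[OF fin, of "{{..<?k}}" "\<lambda>P. \<Prod>D\<in>P. cumulant p (nths zs D)"] part
    by (simp add: eq nths)
  also have "\<dots> = p zs / (\<Prod>z\<leftarrow>zs. p [z])"
    using assms by (subst cumulant.simps) simp
  finally show ?thesis by simp
qed

definition coverage_reweighted_moment_stationary ::
  "'w measure \<Rightarrow> ('w \<Rightarrow> 2 \<Rightarrow> 'a::euclidean_space measure) \<Rightarrow> (('a \<times> 2) list \<Rightarrow> real) \<Rightarrow> bool" where
  "coverage_reweighted_moment_stationary M \<Psi> p \<longleftrightarrow>
     random_measure M \<Psi> \<and> moments_locally_finite M \<Psi> \<and> coverage_functions M \<Psi> p \<and>
     0 < (INF z. p [z]) \<and>
     (\<forall>k\<ge>1. \<forall>i a. AE x in (\<Pi>\<^sub>M j\<in>{..<k}. lborel).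
        cumulant p (labelled k (\<lambda>j. x j + a) i) = cumulant p (labelled k x i))"

definition cross_K :: "(('a::euclidean_space \<times> 2) list \<Rightarrow> real) \<Rightarrow> real \<Rightarrow> real" where
  "cross_K p t = (LINT x:cball 0 t|lborel. 1 + cumulant p [(0, 1), (x, 2)])"

section \<open>Palm distributions, Laplace functionals and the cross J-function\<close>

definition intensity_measure ::
  "'w measure \<Rightarrow> ('w \<Rightarrow> 2 \<Rightarrow> 'a::euclidean_space measure) \<Rightarrow> 2 \<Rightarrow> 'a measure" where
  "intensity_measure M \<Psi> i = measure_of UNIV (sets borel) (\<lambda>B. \<integral>\<^sup>+\<omega>. emeasure (\<Psi> \<omega> i) B \<partial>M)"

text \<open>\<open>P x i\<close> is the distribution of the random measure under the Palm measure at \<open>(x, i)\<close>.\<close>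

definition palm_distributions ::
  "'w measure \<Rightarrow> ('w \<Rightarrow> 2 \<Rightarrow> 'a::euclidean_space measure) \<Rightarrow> ('a \<Rightarrow> 2 \<Rightarrow> (2 \<Rightarrow> 'a measure) measure) \<Rightarrow> bool"
where
  "palm_distributions M \<Psi> P \<longleftrightarrow>
     (\<forall>i. (\<lambda>x. P x i) \<in> borel \<rightarrow>\<^sub>M prob_algebra bivariate_measures) \<and>
     (\<forall>g :: ('a \<times> 2) \<times> (2 \<Rightarrow> 'a measure) \<Rightarrow> ennreal.
        g \<in> borel_measurable ((borel \<Otimes>\<^sub>M count_space UNIV) \<Otimes>\<^sub>M bivariate_measures) \<longrightarrow>
        (\<integral>\<^sup>+\<omega>. (\<Sum>i\<in>UNIV. \<integral>\<^sup>+x. g ((x, i), \<Psi> \<omega>) \<partial>\<Psi> \<omega> i) \<partial>M) =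
        (\<Sum>i\<in>UNIV. \<integral>\<^sup>+x. (\<integral>\<^sup>+\<psi>. g ((x, i), \<psi>) \<partial>P x i) \<partial>intensity_measure M \<Psi> i))"

definition exp_neg :: "ennreal \<Rightarrow> real" where
  "exp_neg v = (if v = \<infinity> then 0 else exp (- enn2real v))"

definition laplace ::
  "'w measure \<Rightarrow> ('w \<Rightarrow> 2 \<Rightarrow> 'a::euclidean_space measure) \<Rightarrow> ('a \<times> 2 \<Rightarrow> ennreal) \<Rightarrow> real" where
  "laplace M \<Psi> u = (\<integral>\<omega>. exp_neg (\<Sum>i\<in>UNIV. \<integral>\<^sup>+x. u (x, i) \<partial>\<Psi> \<omega> i) \<partial>M)"

definition J_test ::
  "(('a::euclidean_space \<times> 2) list \<Rightarrow> real) \<Rightarrow> real \<Rightarrow> 'a \<Rightarrow> 'a \<times> 2 \<Rightarrow> ennreal" where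
  "J_test p t a z = ennreal (indicator (cball a t \<times> {2}) z / p [z])"

text \<open>The common value, for almost all \<open>a\<close>, of the ratio of the Laplace functional under the Palm
  distribution at \<open>(a, 1)\<close> to the Laplace functional of \<open>\<Psi>\<close>. The choice of the version of the Palm
  distributions is irrelevant, as they are determined up to null sets of the intensity measure.\<close>

definition cross_J ::
  "'w measure \<Rightarrow> ('w \<Rightarrow> 2 \<Rightarrow> 'a::euclidean_space measure) \<Rightarrow> (('a \<times> 2) list \<Rightarrow> real) \<Rightarrow> real \<Rightarrow> real" where
  "cross_J M \<Psi> p t = (THE J. \<exists>P. palm_distributions M \<Psi> P \<and>
     (AE a in lborel. laplace (P a 1) (\<lambda>\<psi>. \<psi>) (J_test p t a) / laplace M \<Psi> (J_test p t a) = J))"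

section \<open>Random closed sets, germ-grain models and empty space functions\<close>

definition coverage_measure :: "('w \<Rightarrow> 2 \<Rightarrow> 'a::euclidean_space set) \<Rightarrow> 'w \<Rightarrow> 2 \<Rightarrow> 'a measure" where
  "coverage_measure X \<omega> i = density lborel (indicator (X \<omega> i))"

definition coverage_prob ::
  "'w measure \<Rightarrow> ('w \<Rightarrow> 2 \<Rightarrow> 'a::euclidean_space set) \<Rightarrow> ('a \<times> 2) list \<Rightarrow> real" where
  "coverage_prob M X zs = measure M {\<omega>\<in>space M. \<forall>(x, i)\<in>set zs. x \<in> X \<omega> i}"

definition scale_set ::
  "real \<Rightarrow> ('w \<Rightarrow> 2 \<Rightarrow> 'a::euclidean_space set) \<Rightarrow> 'w \<Rightarrow> 2 \<Rightarrow> 'a set" where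
  "scale_set s X \<omega> i = (\<lambda>x. s *\<^sub>R x) ` X \<omega> i"

definition germ_grain ::
  "real \<Rightarrow> ('w \<Rightarrow> 2 \<Rightarrow> 'a::euclidean_space measure) \<Rightarrow> 'w \<Rightarrow> 2 \<Rightarrow> 'a set" where
  "germ_grain r N \<omega> i = (\<Union>x\<in>points (N \<omega> i). cball x r)"

text \<open>Unlike \<open>infdist\<close>, this is infinite for the empty set.\<close>

definition set_dist :: "'a::metric_space \<Rightarrow> 'a set \<Rightarrow> ennreal" where
  "set_dist x A = (INF y\<in>A. ennreal (dist x y))"

definition joint_empty_space ::
  "'w measure \<Rightarrow> ('w \<Rightarrow> 2 \<Rightarrow> 'a::euclidean_space measure) \<Rightarrow> real \<Rightarrow> real \<Rightarrow> 'a \<Rightarrow> real" where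
  "joint_empty_space M N t1 t2 x =
     measure M {\<omega>\<in>space M. set_dist 0 (points (N \<omega> 1)) \<le> ennreal t1 \<and>
                          set_dist x (points (N \<omega> 2)) \<le> ennreal t2}"

definition empty_space ::
  "'w measure \<Rightarrow> ('w \<Rightarrow> 2 \<Rightarrow> 'a::euclidean_space measure) \<Rightarrow> 2 \<Rightarrow> real \<Rightarrow> real" where
  "empty_space M N i t = measure M {\<omega>\<in>space M. set_dist 0 (points (N \<omega> i)) \<le> ennreal t}"

end

theory Submission
  imports Defs
begin

text \<open>
  Everything rests on the equivalence \<open>x \<in> X\<^sub>i \<longleftrightarrow> N\<^sub>i(B(x,r)) \<noteq> 0\<close>: an integer-valued locally finite
  measure charges a closed ball exactly if it has an atom there
  (\<open>emeasure_cball_nonzero_iff\<close>), and then the infimum in the distance to the set of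
  atoms is attained (\<open>set_dist_points_le_iff\<close>). Hence all coverage probabilities are probabilities
  of events \<open>N\<^sub>i(B(x,r)) \<noteq> 0\<close>. They inherit translation invariance from \<open>N\<close>, the cumulant densities
  inherit it from them, and the formula for \<open>K\<^sub>1\<^sub>2\<close> is the identity
  \<open>1 + \<xi>\<^sub>2 = p\<^sub>2 / (p\<^sub>1 p\<^sub>1)\<close>.

  For \<open>J\<^sub>1\<^sub>2\<close>, the coverage measure \<open>\<Psi>\<close> of a random closed set has an explicit Palm distribution at
  \<open>(x,i)\<close>: the law of \<open>\<Psi>\<close> given \<open>x \<in> X\<^sub>i\<close>. By Fubini's theorem this law satisfies the Campbell formula
  (\<open>palm_distributions_palm\<close>). If the ratio of Laplace functionals under any other version of the
  Palm distributions is almost everywhere constant, the Campbell formula, applied to the Laplace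
  integrand restricted to the unit ball, determines the constant
  (\<open>palm_laplace_unique\<close>). For \<open>sX\<close> and radius \<open>st\<close>, scaling and translation turn the ratio into
  \<open>E[1{0 \<in> X\<^sub>1} exp(-c s\<^sup>d V)] / (F\<^sub>1(r) E[exp(-c s\<^sup>d V)])\<close>, where \<open>V\<close> is the volume of
  \<open>X\<^sub>2 \<inter> B(0,t)\<close> and \<open>c\<close> is the reciprocal of \<open>F\<^sub>2(r)\<close> (\<open>cross_J_scaled\<close>).

  As \<open>s \<rightarrow> \<infinity>\<close> the exponential tends to \<open>1{V = 0}\<close>, by dominated convergence also in mean. Finally
  \<open>V = 0\<close> almost surely means that \<open>N\<^sub>2\<close> has no point in \<open>B(0,r+t)\<close>. A point in the open ball produces
  a grain that meets the interior of \<open>B(0,t)\<close> (\<open>hit_volume_positive\<close>). A point on the bounding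
  sphere may contribute no volume, but almost surely there is none (\<open>AE_no_points_on_sphere\<close>):
  the points \<open>x\<close> at distance exactly \<open>r + t\<close> from some point of \<open>N\<^sub>2\<close> form a countable union of
  spheres, a Lebesgue null set, and by stationarity the probability that \<open>x\<close> has such a point of
  \<open>N\<^sub>2\<close> at this distance, but none closer, is the same for all \<open>x\<close>.
\<close>

section \<open>Measurability on the space of pairs of measures\<close>

lemma space_bivariate_measures:
  "space bivariate_measures = {\<psi>. \<forall>i. locally_finite_measure (\<psi> i)}"
  by (auto simp: bivariate_measures_def space_Sup_eq_UN)

lemma measurable_emeasure_bivariate_measures [measurable]:
  "B \<in> sets borel \<Longrightarrow> (\<lambda>\<psi>. emeasure (\<psi> i) B) \<in> borel_measurable bivariate_measures"
  unfolding bivariate_measures_def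
  by (rule measurable_Sup1[where m = "vimage_algebra {\<psi>. \<forall>i. locally_finite_measure (\<psi> i)}
        (\<lambda>\<psi>. emeasure (\<psi> i) B) borel"])
     (auto intro!: measurable_vimage_algebra1)

lemma measurable_bivariate_measuresI:
  assumes "\<And>\<omega> i. \<omega> \<in> space M \<Longrightarrow> locally_finite_measure (\<Psi> \<omega> i)"
    and "\<And>i B. B \<in> sets borel \<Longrightarrow> (\<lambda>\<omega>. emeasure (\<Psi> \<omega> i) B) \<in> borel_measurable M"
  shows "\<Psi> \<in> M \<rightarrow>\<^sub>M bivariate_measures"
  unfolding bivariate_measures_def
  using assms by (auto intro!: measurable_Sup2 measurable_vimage_algebra2)

lemma sets_locally_finite_measure [simp]:
  "locally_finite_measure m \<Longrightarrow> sets m = sets borel"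
  by (simp add: locally_finite_measure_def)

lemma emeasure_cball_finite:
  "locally_finite_measure m \<Longrightarrow> emeasure m (cball x t) < \<infinity>"
  unfolding locally_finite_measure_def using bounded_cball borel_closed closed_cball by blast

text \<open>Closed balls are the intersections of their enlargements and have finite mass. A strict upper
  bound on the mass of a closed ball therefore persists for a slightly larger ball, which makes
  \<open>x \<mapsto> m(B(x,t))\<close> upper semicontinuous.\<close>

lemma emeasure_cball_decreasing_limit:
  assumes "locally_finite_measure m"
  shows "(INF n. emeasure m (cball x (t + c / real (Suc n)))) \<le> emeasure m (cball x t)"
proof (cases "c \<ge> 0")
  case True
  have "(INF n. emeasure m (cball x (t + c / real (Suc n)))) =
      emeasure m (\<Inter>n. cball x (t + c / real (Suc n)))"
  proof (rule INF_emeasure_decseq)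
    show "decseq (\<lambda>n. cball x (t + c / real (Suc n)))"
      using True by (intro antimonoI subset_cball) (auto intro!: divide_left_mono)
    show "emeasure m (cball x (t + c / real (Suc n))) \<noteq> \<infinity>" for n
      using emeasure_cball_finite[OF assms] by (metis less_irrefl)
  qed (use assms in auto)
  also have "(\<Inter>n. cball x (t + c / real (Suc n))) = cball x t"
  proof (intro equalityI subsetI)
    fix y assume "y \<in> (\<Inter>n. cball x (t + c / real (Suc n)))"
    then have *: "dist x y \<le> t + c / real (Suc n)" for n by auto
    have "(\<lambda>n. t + c / real (Suc n)) \<longlonglongrightarrow> t + 0"
      by (intro tendsto_add tendsto_const LIMSEQ_Suc[OF lim_const_over_n])
    then have "dist x y \<le> t" using * by (intro LIMSEQ_le_const) auto
    then show "y \<in> cball x t" by simp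
  next
    fix y assume "y \<in> cball x t"
    then have "dist x y \<le> t" by simp
    moreover have "0 \<le> c / real (Suc n)" for n using True by simp
    ultimately have "dist x y \<le> t + c / real (Suc n)" for n
      by (metis add_increasing2)
    then show "y \<in> (\<Inter>n. cball x (t + c / real (Suc n)))" by auto
  qed
  finally show ?thesis by simp
next
  case False
  have "emeasure m (cball x (t + c / real (Suc 0))) \<le> emeasure m (cball x t)"
    using False assms by (intro emeasure_mono subset_cball) auto
  then show ?thesis by (meson INF_lower UNIV_I order_trans)
qed

lemma emeasure_ball_eq_SUP:
  assumes "locally_finite_measure m"
  shows "emeasure m (ball x t) = (SUP n. emeasure m (cball x (t - 1 / real (Suc n))))"
proof -
  have "(SUP n. emeasure m (cball x (t - 1 / real (Suc n)))) =
      emeasure m (\<Union>n. cball x (t - 1 / real (Suc n)))"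
    using assms by (intro SUP_emeasure_incseq incseq_SucI subset_cball) (auto simp: field_simps)
  also have "(\<Union>n. cball x (t - 1 / real (Suc n))) = ball x t"
  proof (intro equalityI subsetI)
    fix y assume "y \<in> ball x t"
    then obtain n where "1 / real (Suc n) < t - dist x y"
      using nat_approx_posE[of "t - dist x y"] by auto
    then show "y \<in> (\<Union>n. cball x (t - 1 / real (Suc n)))"
      by (auto intro!: exI[of _ n])
  next
    fix y assume "y \<in> (\<Union>n. cball x (t - 1 / real (Suc n)))"
    then obtain n where "dist x y \<le> t - 1 / real (Suc n)" by auto
    moreover have "1 / real (Suc n) > 0" by simp
    ultimately show "y \<in> ball x t" by (simp only: mem_ball)
  qed
  finally show ?thesis by simp
qed

text \<open>Joint measurability in the centre and the measure. The mass of \<open>B(x,t)\<close> is less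
  than \<open>c\<close> exactly if some slightly enlarged ball, centred at a nearby point of a countable
  dense set, has mass less than \<open>c\<close>. This makes the event a countable union of measurable
  rectangles.\<close>

lemma measurable_emeasure_cball_pair:
  fixes i :: 2 and t :: real
  shows "(\<lambda>(x :: 'a::euclidean_space, \<psi>). emeasure (\<psi> i) (cball x t))
    \<in> borel_measurable (borel \<Otimes>\<^sub>M bivariate_measures)"
proof (rule borel_measurableI_less)
  fix c :: ennreal
  obtain D :: "'a set" where D: "countable D" "\<And>X. open X \<Longrightarrow> X \<noteq> {} \<Longrightarrow> \<exists>d\<in>D. d \<in> X"
    using countable_dense_setE by blast
  let ?e = "\<lambda>n. 1 / real (Suc n)"
  have eq: "{z \<in> space (borel \<Otimes>\<^sub>M bivariate_measures). (\<lambda>(x, \<psi>). emeasure (\<psi> i) (cball x t)) z < c} =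
      (\<Union>n. \<Union>q\<in>D. ball q (?e n) \<times>
        {\<psi> \<in> space bivariate_measures. emeasure (\<psi> i) (cball q (t + ?e n)) < c})" (is "?L = ?R")
  proof (intro equalityI subsetI)
    fix z assume "z \<in> ?L"
    then obtain x \<psi> where z: "z = (x, \<psi>)" and \<psi>: "\<psi> \<in> space bivariate_measures"
      and less: "emeasure (\<psi> i) (cball x t) < c"
      by (auto simp: space_pair_measure)
    have fin: "locally_finite_measure (\<psi> i)" using \<psi> by (simp add: space_bivariate_measures)
    obtain n where n: "emeasure (\<psi> i) (cball x (t + 2 / real (Suc n))) < c"
      using le_less_trans[OF emeasure_cball_decreasing_limit[OF fin] less, of 2]
      by (auto simp: INF_less_iff)
    obtain q where q: "q \<in> D" "q \<in> ball x (?e n)"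
      using D(2)[of "ball x (?e n)"] by auto
    have "cball q (t + ?e n) \<subseteq> cball x (t + 2 / real (Suc n))"
    proof
      fix y assume "y \<in> cball q (t + ?e n)"
      then have "dist x y \<le> ?e n + (t + ?e n)"
        using q(2) dist_triangle[of x y q] by simp
      then show "y \<in> cball x (t + 2 / real (Suc n))" by simp
    qed
    then have "emeasure (\<psi> i) (cball q (t + ?e n)) < c"
      using fin by (intro le_less_trans[OF emeasure_mono n]) auto
    then have "z \<in> ball q (?e n) \<times>
        {\<psi> \<in> space bivariate_measures. emeasure (\<psi> i) (cball q (t + ?e n)) < c}"
      using z q \<psi> by (simp add: dist_commute)
    then show "z \<in> ?R" using q(1) by blast
  next
    fix z assume "z \<in> ?R"
    then obtain n q x \<psi> where z: "z = (x, \<psi>)" "x \<in> ball q (?e n)" "\<psi> \<in> space bivariate_measures"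
      "emeasure (\<psi> i) (cball q (t + ?e n)) < c" by auto
    have "cball x t \<subseteq> cball q (t + ?e n)"
    proof
      fix y assume "y \<in> cball x t"
      then show "y \<in> cball q (t + ?e n)"
        using z(2) dist_triangle[of q y x] by simp
    qed
    then have "emeasure (\<psi> i) (cball x t) < c"
      using z(3,4) by (auto simp: space_bivariate_measures intro: le_less_trans[OF emeasure_mono])
    then show "z \<in> ?L" using z by (simp add: space_pair_measure)
  qed
  have box: "ball q (?e n) \<times> {\<psi> \<in> space bivariate_measures. emeasure (\<psi> i) (cball q (t + ?e n)) < c}
      \<in> sets (borel \<Otimes>\<^sub>M bivariate_measures)" for q n
    by (intro pair_measureI) auto
  have "?R \<in> sets (borel \<Otimes>\<^sub>M bivariate_measures)"
    using box D(1) by (intro sets.countable_UN image_subsetI sets.countable_UN') auto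
  with eq show "?L \<in> sets (borel \<Otimes>\<^sub>M bivariate_measures)"
    by argo
qed

lemma measurable_emeasure_cball [measurable (raw)]:
  assumes [measurable]: "f \<in> borel_measurable K" "\<Psi> \<in> K \<rightarrow>\<^sub>M bivariate_measures"
  shows "(\<lambda>z. emeasure (\<Psi> z i) (cball (f z) t)) \<in> borel_measurable K"
proof -
  have "(\<lambda>z. (f z, \<Psi> z)) \<in> K \<rightarrow>\<^sub>M borel \<Otimes>\<^sub>M bivariate_measures" by simp
  from measurable_compose[OF this measurable_emeasure_cball_pair, of i t] show ?thesis by simp
qed

lemma measurable_emeasure_ball [measurable (raw)]:
  assumes [measurable]: "f \<in> borel_measurable K" "\<Psi> \<in> K \<rightarrow>\<^sub>M bivariate_measures"
  shows "(\<lambda>z. emeasure (\<Psi> z i) (ball (f z) t)) \<in> borel_measurable K"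
proof -
  have "(\<lambda>z. SUP n. emeasure (\<Psi> z i) (cball (f z) (t - 1 / real (Suc n)))) \<in> borel_measurable K"
    by measurable
  moreover have "locally_finite_measure (\<Psi> z i)" if "z \<in> space K" for z
    using measurable_space[OF assms(2) that] by (simp add: space_bivariate_measures)
  ultimately show ?thesis
    by (subst measurable_cong[OF emeasure_ball_eq_SUP]) auto
qed

lemma emeasure_translate:
  assumes "\<psi> \<in> space bivariate_measures" "B \<in> sets borel"
  shows "emeasure (translate a \<psi> i) B = emeasure (\<psi> i) ((\<lambda>x. x + a) -` B)"
proof -
  have s: "sets (\<psi> i) = sets borel" using assms(1) by (simp add: space_bivariate_measures)
  then have "space (\<psi> i) = UNIV" by (metis sets_eq_imp_space_eq space_borel)
  moreover have "(\<lambda>x. x + a) \<in> \<psi> i \<rightarrow>\<^sub>M borel"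
    using s by (simp cong: measurable_cong_sets)
  ultimately show ?thesis
    unfolding translate_def using assms(2) by (subst emeasure_distr) auto
qed

lemma measurable_translate [measurable]: "translate a \<in> bivariate_measures \<rightarrow>\<^sub>M bivariate_measures"
proof (rule measurable_bivariate_measuresI)
  fix \<psi> :: "2 \<Rightarrow> 'a measure" and i assume \<psi>: "\<psi> \<in> space bivariate_measures"
  have lf: "locally_finite_measure (\<psi> i)" using \<psi> by (simp add: space_bivariate_measures)
  have vimage: "(\<lambda>x. x + a) -` B = (\<lambda>x. x - a) ` B" for B :: "'a set"
    by (force simp: image_iff algebra_simps)
  show "locally_finite_measure (translate a \<psi> i)"
    unfolding locally_finite_measure_def
  proof (intro conjI ballI impI)
    fix B :: "'a set" assume B: "B \<in> sets borel" "bounded B"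
    have "(\<lambda>x. x + a) -` B \<in> sets borel"
      using B(1) measurable_sets_borel[of "\<lambda>x. x + a" borel B] by simp
    moreover have "bounded ((\<lambda>x. x + a) -` B)"
      unfolding vimage using bounded_translation_minus[OF B(2)] .
    ultimately show "emeasure (translate a \<psi> i) B < \<infinity>"
      using lf unfolding emeasure_translate[OF \<psi> B(1)] locally_finite_measure_def by blast
  qed (simp add: translate_def)
next
  fix i :: 2 and B :: "'a set" assume B: "B \<in> sets borel"
  then have "(\<lambda>x. x + a) -` B \<in> sets borel"
    using measurable_sets_borel[of "\<lambda>x. x + a" borel B] by simp
  then have "(\<lambda>\<psi>. emeasure (\<psi> i) ((\<lambda>x. x + a) -` B)) \<in> borel_measurable bivariate_measures"
    by measurable
  then show "(\<lambda>\<psi>. emeasure (translate a \<psi> i) B) \<in> borel_measurable bivariate_measures"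
    by (subst measurable_cong[OF emeasure_translate[OF _ B]])
qed

text \<open>Stationarity is an identity of laws; this is the form in which it is applied.\<close>

lemma stationary_integral:
  fixes N :: "'w \<Rightarrow> 2 \<Rightarrow> 'a::euclidean_space measure"
    and h :: "(2 \<Rightarrow> 'a measure) \<Rightarrow> real"
  assumes "stationary M N" and [measurable]: "N \<in> M \<rightarrow>\<^sub>M bivariate_measures"
    and [measurable]: "h \<in> borel_measurable bivariate_measures"
  shows "(\<integral>\<omega>. h (translate a (N \<omega>)) \<partial>M) = (\<integral>\<omega>. h (N \<omega>) \<partial>M)"
proof -
  have "(\<integral>\<omega>. h (translate a (N \<omega>)) \<partial>M) =
      (\<integral>\<psi>. h \<psi> \<partial>distr M bivariate_measures (\<lambda>\<omega>. translate a (N \<omega>)))"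
    by (subst integral_distr) auto
  also have "\<dots> = (\<integral>\<psi>. h \<psi> \<partial>distr M bivariate_measures N)"
    using assms(1) by (simp add: stationary_def)
  also have "\<dots> = (\<integral>\<omega>. h (N \<omega>) \<partial>M)"
    by (subst integral_distr) auto
  finally show ?thesis .
qed

section \<open>Integer-valued measures and their atoms\<close>

definition integer_valued :: "'a::euclidean_space measure \<Rightarrow> bool" where
  "integer_valued m \<longleftrightarrow> locally_finite_measure m \<and>
     (\<forall>B\<in>sets borel. bounded B \<longrightarrow> emeasure m B \<in> \<nat>)"

lemma integer_valued_less_1:
  assumes "integer_valued m" "B \<in> sets borel" "bounded B" "emeasure m B < 1"
  shows "emeasure m B = 0"
proof -
  have "emeasure m B \<in> \<nat>" using assms by (simp add: integer_valued_def)
  then obtain n where n: "emeasure m B = of_nat n" by (rule Nats_cases)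
  then have "n < 1" using assms(4) by (cases n) auto
  then show ?thesis using n by simp
qed

text \<open>Without atoms in \<open>K\<close>, each point of \<open>K\<close> has a ball around it of mass
  less than \<open>1\<close>, hence of mass \<open>0\<close>, and finitely many of these balls cover
  \<open>K\<close>.\<close>

lemma integer_valued_compact_atom:
  assumes m: "integer_valued m" and K: "compact K" and pos: "emeasure m K \<noteq> 0"
  shows "\<exists>x\<in>K. x \<in> points m"
proof (rule ccontr)
  assume "\<not> (\<exists>x\<in>K. x \<in> points m)"
  then have null: "emeasure m {x} = 0" if "x \<in> K" for x using that by (auto simp: points_def)
  have fin: "locally_finite_measure m" using m by (simp add: integer_valued_def)
  have ex: "\<exists>e>0. emeasure m (cball x e) = 0" if "x \<in> K" for x
  proof -
    have "(INF n. emeasure m (cball x (0 + 1 / real (Suc n)))) < 1"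
      using emeasure_cball_decreasing_limit[OF fin, of x 0 1] null[OF that] by simp
    then obtain n where "emeasure m (cball x (0 + 1 / real (Suc n))) < 1"
      by (auto simp: INF_less_iff)
    then have "emeasure m (cball x (1 / real (Suc n))) = 0"
      by (intro integer_valued_less_1[OF m]) auto
    then show ?thesis by (intro exI[of _ "1 / real (Suc n)"]) auto
  qed
  then obtain e where e: "\<And>x. x \<in> K \<Longrightarrow> e x > 0 \<and> emeasure m (cball x (e x)) = 0" by metis
  obtain C where C: "C \<subseteq> K" "finite C" "K \<subseteq> (\<Union>x\<in>C. ball x (e x))"
  proof (rule compactE_image[OF K, of K "\<lambda>x. ball x (e x)"])
    show "K \<subseteq> (\<Union>x\<in>K. ball x (e x))" using e by force
  qed auto
  have "K \<subseteq> (\<Union>x\<in>C. cball x (e x))"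
    by (rule order_trans[OF C(3)]) (intro UN_mono ball_subset_cball order_refl)
  then have "emeasure m K \<le> emeasure m (\<Union>x\<in>C. cball x (e x))"
    using C(2) fin by (intro emeasure_mono sets.finite_UN) auto
  also have "\<dots> \<le> (\<Sum>x\<in>C. emeasure m (cball x (e x)))"
    using C fin by (intro emeasure_subadditive_finite) auto
  also have "\<dots> = 0" using C e by (simp add: subset_iff)
  finally show False using pos by simp
qed

lemma emeasure_cball_nonzero_iff:
  assumes m: "integer_valued m"
  shows "emeasure m (cball x t) \<noteq> 0 \<longleftrightarrow> (\<exists>y\<in>points m. dist x y \<le> t)"
proof
  assume "emeasure m (cball x t) \<noteq> 0"
  then show "\<exists>y\<in>points m. dist x y \<le> t"
    using integer_valued_compact_atom[OF m compact_cball] by (metis mem_cball)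
next
  assume "\<exists>y\<in>points m. dist x y \<le> t"
  then obtain y where y: "emeasure m {y} \<noteq> 0" "dist x y \<le> t" by (auto simp: points_def)
  have "emeasure m {y} \<le> emeasure m (cball x t)"
    using y(2) m by (intro emeasure_mono) (auto simp: integer_valued_def)
  then show "emeasure m (cball x t) \<noteq> 0" using y(1) by auto
qed

lemma emeasure_ball_nonzero_iff:
  assumes m: "integer_valued m"
  shows "emeasure m (ball x t) \<noteq> 0 \<longleftrightarrow> (\<exists>y\<in>points m. dist x y < t)"
proof
  have fin: "locally_finite_measure m" using m by (simp add: integer_valued_def)
  assume "emeasure m (ball x t) \<noteq> 0"
  then have "(SUP n. emeasure m (cball x (t - 1 / real (Suc n)))) \<noteq> 0"
    unfolding emeasure_ball_eq_SUP[OF fin] .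
  then have "\<exists>n. emeasure m (cball x (t - 1 / real (Suc n))) \<noteq> 0"
    by (rule contrapos_np) (simp del: of_nat_Suc)
  then obtain n y where "y \<in> points m" and y: "dist x y \<le> t - 1 / real (Suc n)"
    using emeasure_cball_nonzero_iff[OF m] by blast
  moreover have "0 < 1 / real (Suc n)" by simp
  with y have "dist x y < t" by linarith
  ultimately show "\<exists>y\<in>points m. dist x y < t" by blast
next
  assume "\<exists>y\<in>points m. dist x y < t"
  then obtain y where y: "emeasure m {y} \<noteq> 0" "dist x y < t" by (auto simp: points_def)
  have "emeasure m {y} \<le> emeasure m (ball x t)"
    using y(2) m by (intro emeasure_mono) (auto simp: integer_valued_def)
  then show "emeasure m (ball x t) \<noteq> 0" using y(1) by auto
qed

text \<open>For an infimum of distances at most \<open>t\<close>, all balls of radius larger than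
  \<open>t\<close> have mass at least \<open>1\<close>. By continuity from above the mass of the ball of
  radius \<open>t\<close> is then at least \<open>1\<close> as well, so that the infimum is
  attained.\<close>

lemma set_dist_points_le_iff:
  assumes m: "integer_valued m" and t: "0 \<le> t"
  shows "set_dist x (points m) \<le> ennreal t \<longleftrightarrow> emeasure m (cball x t) \<noteq> 0"
proof
  assume le: "set_dist x (points m) \<le> ennreal t"
  have fin: "locally_finite_measure m" using m by (simp add: integer_valued_def)
  have pos: "emeasure m (cball x (t + 1 / real (Suc n))) \<noteq> 0" for n
  proof -
    have "ennreal t < ennreal (t + 1 / real (Suc n))"
      using t by (simp add: ennreal_less_iff del: of_nat_Suc)
    then have "set_dist x (points m) < ennreal (t + 1 / real (Suc n))" using le by simp
    then obtain y where y: "y \<in> points m" "ennreal (dist x y) < ennreal (t + 1 / real (Suc n))"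
      unfolding set_dist_def INF_less_iff by blast
    from y(2) have "dist x y \<le> t + 1 / real (Suc n)"
      by (simp add: ennreal_less_iff del: of_nat_Suc)
    then show ?thesis
      using emeasure_cball_nonzero_iff[OF m] y(1) by blast
  qed
  have "1 \<le> emeasure m (cball x (t + 1 / real (Suc n)))" for n
    using integer_valued_less_1[OF m borel_closed[OF closed_cball] bounded_cball] pos[of n]
      not_less by blast
  then have "1 \<le> (INF n. emeasure m (cball x (t + 1 / real (Suc n))))"
    by (intro INF_greatest)
  then have "1 \<le> emeasure m (cball x t)"
    using emeasure_cball_decreasing_limit[OF fin, of x t 1] by simp
  then show "emeasure m (cball x t) \<noteq> 0" by auto
next
  assume "emeasure m (cball x t) \<noteq> 0"
  then obtain y where "y \<in> points m" "dist x y \<le> t"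
    using emeasure_cball_nonzero_iff[OF m] by blast
  then show "set_dist x (points m) \<le> ennreal t"
    unfolding set_dist_def using t by (auto intro!: INF_lower2[of y] ennreal_leI)
qed

text \<open>Each atom has mass at least \<open>1\<close>, so that a ball of finite mass contains only
  finitely many.\<close>

lemma countable_points:
  assumes m: "integer_valued m"
  shows "countable (points m)"
proof -
  have fin: "finite (points m \<inter> cball 0 (real n))" for n
  proof (rule ccontr)
    assume "infinite (points m \<inter> cball 0 (real n))"
    let ?c = "emeasure m (cball 0 (real n))"
    have "?c < \<infinity>" using m by (intro emeasure_cball_finite) (simp add: integer_valued_def)
    moreover have "of_nat k \<le> ?c" for k
    proof -
      obtain F where F: "F \<subseteq> points m \<inter> cball 0 (real n)" "finite F" "card F = k"
        using infinite_arbitrarily_large[OF \<open>infinite _\<close>] by blast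
      have one: "1 \<le> emeasure m {y}" if "y \<in> F" for y
      proof (rule ccontr)
        assume "\<not> 1 \<le> emeasure m {y}"
        then have "emeasure m {y} = 0"
          by (intro integer_valued_less_1[OF m]) (auto simp: not_le)
        then show False using that F(1) by (auto simp: points_def)
      qed
      have "of_nat k = (\<Sum>y\<in>F. (1::ennreal))" using F by simp
      also have "\<dots> \<le> (\<Sum>y\<in>F. emeasure m {y})" by (intro sum_mono one)
      also have "\<dots> = emeasure m F"
        using F(2) m by (intro emeasure_eq_sum_singleton[symmetric]) (auto simp: integer_valued_def)
      also have "\<dots> \<le> ?c" using F m by (intro emeasure_mono) (auto simp: integer_valued_def)
      finally show ?thesis .
    qed
    ultimately show False
      using ennreal_Ex_less_of_nat[of ?c] by (metis infinity_ennreal_def leD)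
  qed
  have "points m \<subseteq> (\<Union>n. points m \<inter> cball 0 (real n))"
  proof
    fix y assume "y \<in> points m"
    moreover obtain n where "norm y \<le> real n" using real_arch_simple by blast
    ultimately show "y \<in> (\<Union>n. points m \<inter> cball 0 (real n))" by auto
  qed
  then show ?thesis
    by (rule countable_subset) (intro countable_UN countable_finite fin countableI_type)
qed

section \<open>Facts about Lebesgue measure\<close>

lemma emeasure_lborel_bounded: "bounded B \<Longrightarrow> emeasure lborel (B :: 'b::euclidean_space set) < \<infinity>"
  using emeasure_bounded_finite by auto

lemma emeasure_lborel_open_pos:
  fixes S :: "'a::euclidean_space set"
  assumes "open S" "S \<noteq> {}"
  shows "0 < emeasure lborel S"
proof -
  obtain x e where e: "0 < e" "ball x e \<subseteq> S" using assms open_contains_ball by blast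
  have "0 < ennreal (unit_ball_vol (real DIM('a)) * e ^ DIM('a))"
    using e(1) by (simp add: unit_ball_vol_pos)
  also have "\<dots> = emeasure lborel (ball x e)" using e(1) by (simp add: emeasure_ball)
  also have "\<dots> \<le> emeasure lborel S" using e(2) assms(1) by (intro emeasure_mono) auto
  finally show ?thesis .
qed

lemma sphere_null_sets: "sphere a t \<in> null_sets (lborel :: 'a::euclidean_space measure)"
  using negligible_sphere[of a t] by (auto simp: null_sets_completion_iff negligible_iff_null_sets)

text \<open>Change of variables, used with \<open>c = 1\<close> for translations and with
  \<open>t = 0\<close> for dilations.\<close>

lemma emeasure_lborel_affine_vimage:
  fixes S :: "'a::euclidean_space set"
  assumes [measurable]: "S \<in> sets borel" and c: "c \<noteq> 0"
  shows "emeasure lborel S = ennreal (\<bar>c\<bar> ^ DIM('a)) * emeasure lborel ((\<lambda>x. t + c *\<^sub>R x) -` S)"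
proof -
  have "emeasure lborel S =
      emeasure (density (distr lborel borel (\<lambda>x. t + c *\<^sub>R x)) (\<lambda>_. ennreal (\<bar>c\<bar> ^ DIM('a)))) S"
    using lborel_affine[OF c, of t] by simp
  also have "\<dots> = ennreal (\<bar>c\<bar> ^ DIM('a)) * emeasure (distr lborel borel (\<lambda>x. t + c *\<^sub>R x)) S"
    by (subst emeasure_density) (auto simp: nn_integral_cmult_indicator)
  also have "emeasure (distr lborel borel (\<lambda>x. t + c *\<^sub>R x)) S = emeasure lborel ((\<lambda>x. t + c *\<^sub>R x) -` S)"
    by (subst emeasure_distr) auto
  finally show ?thesis .
qed

section \<open>Coverage measures of random sets\<close>

text \<open>Joint measurability of the indicator in the point and the outcome is what Fubini's theorem
  asks for; for germ-grain models it comes from the joint measurability of masses of balls.\<close>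

locale random_set = prob_space M for M :: "'w measure" +
  fixes Y :: "'w \<Rightarrow> 2 \<Rightarrow> 'a::euclidean_space set"
  assumes pred_mem_pair: "Measurable.pred (borel \<Otimes>\<^sub>M M) (\<lambda>(x, \<omega>). x \<in> Y \<omega> i)"
begin

lemma pred_mem [measurable (raw)]:
  assumes [measurable]: "f \<in> K \<rightarrow>\<^sub>M borel" "g \<in> K \<rightarrow>\<^sub>M M"
  shows "Measurable.pred K (\<lambda>z. f z \<in> Y (g z) i)"
proof -
  have "(\<lambda>z. (f z, g z)) \<in> K \<rightarrow>\<^sub>M borel \<Otimes>\<^sub>M M" by measurable
  from measurable_compose[OF this pred_mem_pair, of i] show ?thesis by simp
qed

lemma borel_section: "\<omega> \<in> space M \<Longrightarrow> Y \<omega> i \<in> sets borel"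
  using pred_mem[of "\<lambda>x. x" borel "\<lambda>_. \<omega>" i] by (simp add: pred_def)

lemma measurable_indicator_mem [measurable (raw)]:
  assumes [measurable]: "f \<in> K \<rightarrow>\<^sub>M borel" "g \<in> K \<rightarrow>\<^sub>M M"
  shows "(\<lambda>z. indicator (Y (g z) i) (f z) :: 'c::{zero_neq_one, second_countable_topology}) \<in> borel_measurable K"
  unfolding indicator_def by measurable

lemma nn_integral_coverage_measure:
  assumes "\<omega> \<in> space M" "f \<in> borel_measurable borel"
  shows "(\<integral>\<^sup>+x. f x \<partial>coverage_measure Y \<omega> i) = (\<integral>\<^sup>+x. indicator (Y \<omega> i) x * f x \<partial>lborel)"
  unfolding coverage_measure_def using assms borel_section[of \<omega> i]
  by (intro nn_integral_density) auto

lemma emeasure_coverage_measure: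
  assumes "\<omega> \<in> space M" "B \<in> sets borel"
  shows "emeasure (coverage_measure Y \<omega> i) B = (\<integral>\<^sup>+x. indicator (Y \<omega> i) x * indicator B x \<partial>lborel)"
  unfolding coverage_measure_def using assms borel_section[of \<omega> i]
  by (intro emeasure_density) auto

lemma emeasure_coverage_measure_Int:
  assumes "\<omega> \<in> space M" "B \<in> sets borel"
  shows "emeasure (coverage_measure Y \<omega> i) B = emeasure lborel (Y \<omega> i \<inter> B)"
  using assms borel_section[of \<omega> i]
  by (simp add: emeasure_coverage_measure indicator_inter_arith[symmetric])

lemma emeasure_coverage_measure_le:
  assumes "\<omega> \<in> space M" "B \<in> sets borel"
  shows "emeasure (coverage_measure Y \<omega> i) B \<le> emeasure lborel B"
  using assms borel_section[of \<omega> i]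
  by (simp add: emeasure_coverage_measure_Int emeasure_mono)

lemma measurable_coverage_measure [measurable]: "coverage_measure Y \<in> M \<rightarrow>\<^sub>M bivariate_measures"
proof (rule measurable_bivariate_measuresI)
  fix \<omega> i assume \<omega>: "\<omega> \<in> space M"
  show "locally_finite_measure (coverage_measure Y \<omega> i)"
    unfolding locally_finite_measure_def
  proof (intro conjI ballI impI)
    fix B :: "'a set" assume "B \<in> sets borel" "bounded B"
    then show "emeasure (coverage_measure Y \<omega> i) B < \<infinity>"
      using emeasure_coverage_measure_le[OF \<omega>] emeasure_lborel_bounded le_less_trans by blast
  qed (simp add: coverage_measure_def)
next
  fix i and B :: "'a set" assume [measurable]: "B \<in> sets borel"
  have "(\<lambda>\<omega>. \<integral>\<^sup>+x. indicator (Y \<omega> i) x * indicator B x \<partial>lborel) \<in> borel_measurable M"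
    by measurable
  then show "(\<lambda>\<omega>. emeasure (coverage_measure Y \<omega> i) B) \<in> borel_measurable M"
    by (subst measurable_cong[OF emeasure_coverage_measure]) auto
qed

lemma coverage_measure_space:
  "\<omega> \<in> space M \<Longrightarrow> coverage_measure Y \<omega> \<in> space bivariate_measures"
  using measurable_space[OF measurable_coverage_measure] .

lemma moments_locally_finite_coverage: "moments_locally_finite M (coverage_measure Y)"
  unfolding moments_locally_finite_def
proof (intro allI impI)
  fix k :: nat and B :: "nat \<Rightarrow> 'a set" and i :: "nat \<Rightarrow> 2"
  assume B: "\<forall>j<k. B j \<in> sets borel \<and> bounded (B j)"
  have "moment M (coverage_measure Y) k B i \<le> (\<integral>\<^sup>+\<omega>. (\<Prod>j<k. emeasure lborel (B j)) \<partial>M)"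
    unfolding moment_def using B
    by (intro nn_integral_mono prod_mono_ennreal) (auto intro!: emeasure_coverage_measure_le)
  also have "\<dots> = (\<Prod>j<k. emeasure lborel (B j))"
    by (simp add: emeasure_space_1)
  also have "\<dots> < \<infinity>"
    using B emeasure_lborel_bounded by (auto simp: ennreal_prod_eq_top less_top[symmetric])
  finally show "moment M (coverage_measure Y) k B i < \<infinity>" .
qed

lemma ennreal_coverage_prob:
  "ennreal (coverage_prob M Y (labelled k x i)) =
     (\<integral>\<^sup>+\<omega>. (\<Prod>j<k. indicator (Y \<omega> (i j)) (x j)) \<partial>M)"
proof -
  let ?A = "{\<omega> \<in> space M. \<forall>j\<in>{..<k}. x j \<in> Y \<omega> (i j)}"
  have A: "?A \<in> sets M" by measurable
  have "coverage_prob M Y (labelled k x i) = prob ?A"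
    unfolding coverage_prob_def labelled_def by (intro arg_cong[where f = prob]) auto
  then have "ennreal (coverage_prob M Y (labelled k x i)) = emeasure M ?A"
    by (simp add: emeasure_eq_measure)
  also have "\<dots> = (\<integral>\<^sup>+\<omega>. indicator ?A \<omega> \<partial>M)" using A by simp
  also have "\<dots> = (\<integral>\<^sup>+\<omega>. (\<Prod>j<k. indicator (Y \<omega> (i j)) (x j)) \<partial>M)"
  proof (rule nn_integral_cong)
    fix \<omega> assume \<omega>: "\<omega> \<in> space M"
    show "indicator ?A \<omega> = (\<Prod>j<k. indicator (Y \<omega> (i j)) (x j) :: ennreal)"
    proof (cases "\<omega> \<in> ?A")
      case True
      then have "(\<Prod>j<k. indicator (Y \<omega> (i j)) (x j) :: ennreal) = (\<Prod>j<k. 1)"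
        by (intro prod.cong) auto
      with True show ?thesis by simp
    next
      case False
      then obtain j where "j < k" "x j \<notin> Y \<omega> (i j)" using \<omega> by auto
      then have "(\<Prod>j<k. indicator (Y \<omega> (i j)) (x j) :: ennreal) = 0"
        by (intro prod_zero) (auto intro!: bexI[of _ j])
      with False show ?thesis by simp
    qed
  qed
  finally show ?thesis .
qed

text \<open>Robbins' theorem: the product of the covered volumes is the integral of the product of the
  indicators, and the expectation is taken under the integral sign.\<close>

lemma coverage_functions_coverage_prob:
  "coverage_functions M (coverage_measure Y) (coverage_prob M Y)"
  unfolding coverage_functions_def
proof (intro conjI allI impI)
  show "0 \<le> coverage_prob M Y zs" for zs by (simp add: coverage_prob_def)
next
  fix k :: nat and i :: "nat \<Rightarrow> 2"
  let ?L = "\<Pi>\<^sub>M j\<in>{..<k}. (lborel :: 'a measure)"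
  have comp: "(\<lambda>x. x j) \<in> ?L \<rightarrow>\<^sub>M borel" if "j < k" for j
    using measurable_component_singleton[of j "{..<k}" "\<lambda>_. lborel :: 'a measure"] that by simp
  have [measurable]: "(\<lambda>(x, \<omega>). (\<Prod>j<k. indicator (Y \<omega> (i j)) (x j)) :: ennreal)
      \<in> borel_measurable (?L \<Otimes>\<^sub>M M)"
    unfolding split_beta
    by (intro borel_measurable_prod_ennreal measurable_indicator_mem measurable_compose[OF measurable_fst comp])
       auto
  have "(\<lambda>x. \<integral>\<^sup>+\<omega>. (\<Prod>j<k. indicator (Y \<omega> (i j)) (x j)) \<partial>M) \<in> borel_measurable ?L"
    by measurable
  then have "(\<lambda>x. enn2real (ennreal (coverage_prob M Y (labelled k x i)))) \<in> borel_measurable ?L"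
    unfolding ennreal_coverage_prob by measurable
  then show "(\<lambda>x. coverage_prob M Y (labelled k x i)) \<in> borel_measurable ?L"
    by (simp add: coverage_prob_def)
  fix B :: "nat \<Rightarrow> 'a set" assume B: "\<forall>j<k. B j \<in> sets borel"
  interpret product_sigma_finite "\<lambda>_::nat. lborel :: 'a measure" ..
  interpret L: sigma_finite_measure ?L by (intro sigma_finite) simp
  interpret pair_sigma_finite ?L M ..
  have [measurable]: "(\<Pi>\<^sub>E j\<in>{..<k}. B j) \<in> sets ?L"
    using B by (intro sets_PiM_I_finite) auto
  have "moment M (coverage_measure Y) k B i =
      (\<integral>\<^sup>+\<omega>. (\<Prod>j<k. \<integral>\<^sup>+x. indicator (Y \<omega> (i j)) x * indicator (B j) x \<partial>lborel) \<partial>M)"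
    unfolding moment_def using B
    by (intro nn_integral_cong prod.cong) (auto simp: emeasure_coverage_measure)
  also have "\<dots> = (\<integral>\<^sup>+\<omega>. (\<integral>\<^sup>+x. (\<Prod>j<k. indicator (Y \<omega> (i j)) (x j) * indicator (B j) (x j)) \<partial>?L) \<partial>M)"
  proof (rule nn_integral_cong)
    fix \<omega> assume "\<omega> \<in> space M"
    then have "(\<lambda>x. indicator (Y \<omega> (i j)) x * indicator (B j) x :: ennreal) \<in> borel_measurable lborel"
      if "j < k" for j using borel_section B that by auto
    then show "(\<Prod>j<k. \<integral>\<^sup>+x. indicator (Y \<omega> (i j)) x * indicator (B j) x \<partial>lborel) =
        (\<integral>\<^sup>+x. (\<Prod>j<k. indicator (Y \<omega> (i j)) (x j) * indicator (B j) (x j)) \<partial>?L)"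
      by (intro product_nn_integral_prod[symmetric]) auto
  qed
  also have "\<dots> = (\<integral>\<^sup>+\<omega>. (\<integral>\<^sup>+x. (\<Prod>j<k. indicator (Y \<omega> (i j)) (x j)) *
      indicator (\<Pi>\<^sub>E j\<in>{..<k}. B j) x \<partial>?L) \<partial>M)"
  proof (intro nn_integral_cong)
    fix \<omega> x assume x: "x \<in> space ?L"
    have "(\<Prod>j<k. indicator (B j) (x j) :: ennreal) = indicator (\<Pi>\<^sub>E j\<in>{..<k}. B j) x"
    proof (cases "\<forall>j<k. x j \<in> B j")
      case True
      then have "(\<Prod>j<k. indicator (B j) (x j) :: ennreal) = (\<Prod>j<k. 1)"
        by (intro prod.cong) auto
      moreover have "x \<in> (\<Pi>\<^sub>E j\<in>{..<k}. B j)" using True x by (auto simp: space_PiM PiE_iff)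
      ultimately show ?thesis by simp
    next
      case False
      then obtain j where "j < k" "x j \<notin> B j" by auto
      then have "(\<Prod>j<k. indicator (B j) (x j) :: ennreal) = 0"
        by (intro prod_zero) (auto intro!: bexI[of _ j])
      moreover have "x \<notin> (\<Pi>\<^sub>E j\<in>{..<k}. B j)" using False by auto
      ultimately show ?thesis by simp
    qed
    then show "(\<Prod>j<k. indicator (Y \<omega> (i j)) (x j) * indicator (B j) (x j) :: ennreal) =
      (\<Prod>j<k. indicator (Y \<omega> (i j)) (x j)) * indicator (\<Pi>\<^sub>E j\<in>{..<k}. B j) x"
      by (simp add: prod.distrib)
  qed
  also have "\<dots> = (\<integral>\<^sup>+x. (\<integral>\<^sup>+\<omega>. (\<Prod>j<k. indicator (Y \<omega> (i j)) (x j)) *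
      indicator (\<Pi>\<^sub>E j\<in>{..<k}. B j) x \<partial>M) \<partial>?L)"
    by (rule Fubini') measurable
  also have "\<dots> = (\<integral>\<^sup>+x\<in>(\<Pi>\<^sub>E j\<in>{..<k}. B j). ennreal (coverage_prob M Y (labelled k x i)) \<partial>?L)"
  proof (rule nn_integral_cong)
    fix x assume x: "x \<in> space ?L"
    have "(\<lambda>\<omega>. (\<Prod>j<k. indicator (Y \<omega> (i j)) (x j)) :: ennreal) \<in> borel_measurable M"
      by measurable
    then show "(\<integral>\<^sup>+\<omega>. (\<Prod>j<k. indicator (Y \<omega> (i j)) (x j)) * indicator (\<Pi>\<^sub>E j\<in>{..<k}. B j) x \<partial>M) =
        ennreal (coverage_prob M Y (labelled k x i)) * indicator (\<Pi>\<^sub>E j\<in>{..<k}. B j) x"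
      by (simp add: nn_integral_multc ennreal_coverage_prob)
  qed
  finally show "moment M (coverage_measure Y) k B i = \<dots>" .
qed

end

section \<open>Palm distributions and the cross J-function of a coverage measure\<close>

lemma measurable_exp_neg [measurable]: "exp_neg \<in> borel_measurable borel"
  unfolding exp_neg_def[abs_def] by measurable

lemma exp_neg_nonneg [simp]: "0 \<le> exp_neg v" and exp_neg_le_1 [simp]: "exp_neg v \<le> 1"
  by (auto simp: exp_neg_def)

lemma exp_neg_ennreal: "0 \<le> v \<Longrightarrow> exp_neg (ennreal v) = exp (- v)"
  by (simp add: exp_neg_def)

lemma exp_neg_pos: "v < \<infinity> \<Longrightarrow> 0 < exp_neg v"
  by (auto simp: exp_neg_def)

text \<open>For a homogeneous set the weight \<open>1 / p\<^sub>1\<close> in the test function is a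
  constant, and the Laplace exponent is a multiple of the mass of a ball.\<close>

lemma sum_nn_integral_J_test:
  fixes q :: "2 \<Rightarrow> real"
  assumes p: "\<And>x i. p [(x, i)] = q i" and \<psi>: "\<psi> \<in> space bivariate_measures"
  shows "(\<Sum>i\<in>UNIV. \<integral>\<^sup>+x. J_test p t a (x, i) \<partial>\<psi> i) =
    ennreal (1 / q 2) * emeasure (\<psi> 2) (cball a t)"
proof -
  have "cball a t \<in> sets (\<psi> 2)" using \<psi> by (simp add: space_bivariate_measures)
  moreover have "J_test p t a (x, 1) = 0"
    and "J_test p t a (x, 2) = ennreal (1 / q 2) * indicator (cball a t) x" for x
    by (auto simp: J_test_def p indicator_def)
  ultimately show ?thesis by (simp add: sum_2 nn_integral_cmult)
qed

text \<open>The integrand of the Laplace functional for the test function \<open>J_test\<close>. For large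
  \<open>c\<close> it approximates the indicator of the event that the second component is void on the
  ball.\<close>

definition void_weight :: "real \<Rightarrow> real \<Rightarrow> 'a::euclidean_space \<Rightarrow> (2 \<Rightarrow> 'a measure) \<Rightarrow> real" where
  "void_weight c t a \<psi> = exp_neg (ennreal c * emeasure (\<psi> 2) (cball a t))"

lemma measurable_void_weight [measurable (raw)]:
  assumes [measurable]: "f \<in> borel_measurable K" "\<Psi> \<in> K \<rightarrow>\<^sub>M bivariate_measures"
  shows "(\<lambda>z. void_weight c t (f z) (\<Psi> z)) \<in> borel_measurable K"
  unfolding void_weight_def by measurable

lemma void_weight_bounds [simp]: "0 \<le> void_weight c t a \<psi>" "void_weight c t a \<psi> \<le> 1"
  by (simp_all add: void_weight_def)

lemma void_weight_pos: "\<psi> \<in> space bivariate_measures \<Longrightarrow> 0 < void_weight c t a \<psi>"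
  unfolding void_weight_def
  by (intro exp_neg_pos)
     (auto simp: space_bivariate_measures ennreal_mult_less_top intro!: emeasure_cball_finite[unfolded infinity_ennreal_def])

lemma laplace_J_test:
  fixes q :: "2 \<Rightarrow> real"
  assumes "\<And>x i. p [(x, i)] = q i" "\<Phi> \<in> M \<rightarrow>\<^sub>M bivariate_measures"
  shows "laplace M \<Phi> (J_test p t a) = (\<integral>\<omega>. void_weight (1 / q 2) t a (\<Phi> \<omega>) \<partial>M)"
  unfolding laplace_def void_weight_def
  using sum_nn_integral_J_test[where p = p and q = q, OF assms(1)] measurable_space[OF assms(2)]
  by (intro Bochner_Integration.integral_cong) auto

locale homogeneous_random_set = random_set M Y
  for M :: "'w measure" and Y :: "'w \<Rightarrow> 2 \<Rightarrow> 'a::euclidean_space set" +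
  fixes q :: "2 \<Rightarrow> real"
  assumes prob_mem: "prob {\<omega> \<in> space M. x \<in> Y \<omega> i} = q i" and q_pos: "0 < q i"
begin

lemma coverage_prob_single: "coverage_prob M Y [(x, i)] = q i"
  using prob_mem by (simp add: coverage_prob_def)

lemma emeasure_mem: "emeasure M {\<omega> \<in> space M. x \<in> Y \<omega> i} = ennreal (q i)"
  by (simp add: emeasure_eq_measure prob_mem)

lemma nn_integral_indicator_mem: "(\<integral>\<^sup>+\<omega>. indicator (Y \<omega> i) x \<partial>M) = ennreal (q i)"
proof -
  have "(\<integral>\<^sup>+\<omega>. indicator (Y \<omega> i) x \<partial>M) = (\<integral>\<^sup>+\<omega>. indicator {\<omega> \<in> space M. x \<in> Y \<omega> i} \<omega> \<partial>M)"
    by (intro nn_integral_cong) (auto simp: indicator_def)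
  then show ?thesis by (simp add: emeasure_mem)
qed

lemma intensity_measure_coverage:
  "intensity_measure M (coverage_measure Y) i = density lborel (\<lambda>_. ennreal (q i))"
proof -
  interpret pair_sigma_finite lborel M ..
  let ?D = "density lborel (\<lambda>_ :: 'a. ennreal (q i))"
  have eq: "(\<integral>\<^sup>+\<omega>. emeasure (coverage_measure Y \<omega> i) B \<partial>M) = emeasure ?D B"
    if B [measurable]: "B \<in> sets borel" for B
  proof -
    have "(\<integral>\<^sup>+\<omega>. emeasure (coverage_measure Y \<omega> i) B \<partial>M) =
        (\<integral>\<^sup>+\<omega>. \<integral>\<^sup>+x. indicator (Y \<omega> i) x * indicator B x \<partial>lborel \<partial>M)"
      by (intro nn_integral_cong) (simp add: emeasure_coverage_measure)
    also have "\<dots> = (\<integral>\<^sup>+x. \<integral>\<^sup>+\<omega>. indicator (Y \<omega> i) x * indicator B x \<partial>M \<partial>lborel)"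
      by (rule Fubini') measurable
    also have "\<dots> = (\<integral>\<^sup>+x. ennreal (q i) * indicator B x \<partial>lborel)"
    proof (rule nn_integral_cong)
      fix x :: 'a
      have "(\<lambda>\<omega>. indicator (Y \<omega> i) x :: ennreal) \<in> borel_measurable M" by measurable
      then show "(\<integral>\<^sup>+\<omega>. indicator (Y \<omega> i) x * indicator B x \<partial>M) = ennreal (q i) * indicator B x"
        by (simp add: nn_integral_multc nn_integral_indicator_mem)
    qed
    also have "\<dots> = emeasure ?D B" by (subst emeasure_density) auto
    finally show ?thesis .
  qed
  have "intensity_measure M (coverage_measure Y) i = measure_of UNIV (sets borel) (emeasure ?D)"
    unfolding intensity_measure_def using eq
    by (intro measure_of_eq) (auto simp: sets.sigma_sets_eq[of borel, simplified])
  also have "\<dots> = ?D"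
    using measure_of_of_measure[of ?D] by simp
  finally show ?thesis .
qed

definition palm :: "'a \<Rightarrow> 2 \<Rightarrow> (2 \<Rightarrow> 'a measure) measure" where
  "palm x i = distr (uniform_measure M {\<omega> \<in> space M. x \<in> Y \<omega> i}) bivariate_measures (coverage_measure Y)"

lemma nn_integral_palm:
  assumes [measurable]: "f \<in> borel_measurable bivariate_measures"
  shows "(\<integral>\<^sup>+\<psi>. f \<psi> \<partial>palm x i) =
    (\<integral>\<^sup>+\<omega>. f (coverage_measure Y \<omega>) * indicator (Y \<omega> i) x \<partial>M) / ennreal (q i)"
proof -
  have "(\<integral>\<^sup>+\<psi>. f \<psi> \<partial>palm x i) =
      (\<integral>\<^sup>+\<omega>. f (coverage_measure Y \<omega>) \<partial>uniform_measure M {\<omega> \<in> space M. x \<in> Y \<omega> i})"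
    unfolding palm_def by (intro nn_integral_distr) auto
  also have "\<dots> = (\<integral>\<^sup>+\<omega>. f (coverage_measure Y \<omega>) * indicator {\<omega> \<in> space M. x \<in> Y \<omega> i} \<omega> \<partial>M) /
      ennreal (q i)"
    by (subst nn_integral_uniform_measure) (auto simp: emeasure_mem)
  also have "(\<integral>\<^sup>+\<omega>. f (coverage_measure Y \<omega>) * indicator {\<omega> \<in> space M. x \<in> Y \<omega> i} \<omega> \<partial>M) =
      (\<integral>\<^sup>+\<omega>. f (coverage_measure Y \<omega>) * indicator (Y \<omega> i) x \<partial>M)"
    by (intro nn_integral_cong) (auto simp: indicator_def)
  finally show ?thesis .
qed

lemma prob_space_palm: "prob_space (palm x i)"
  unfolding palm_def
  using q_pos[of i]
  by (intro prob_space.prob_space_distr prob_space_uniform_measure) (auto simp: emeasure_mem)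

lemma sets_palm [measurable_cong, simp]: "sets (palm x i) = sets bivariate_measures"
  by (simp add: palm_def)

lemma measurable_palm: "(\<lambda>x. palm x i) \<in> borel \<rightarrow>\<^sub>M prob_algebra bivariate_measures"
proof (rule measurable_prob_algebraI[OF prob_space_palm measurable_subprob_algebra])
  fix A assume A [measurable]: "A \<in> sets (bivariate_measures :: (2 \<Rightarrow> 'a measure) measure)"
  have "emeasure (palm x i) A =
      (\<integral>\<^sup>+\<omega>. indicator A (coverage_measure Y \<omega>) * indicator (Y \<omega> i) x \<partial>M) / ennreal (q i)" for x
    using nn_integral_palm[of "indicator A" x i] by simp
  moreover have "(\<lambda>x. (\<integral>\<^sup>+\<omega>. indicator A (coverage_measure Y \<omega>) * indicator (Y \<omega> i) x \<partial>M) / ennreal (q i))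
      \<in> borel_measurable borel"
    by measurable
  ultimately show "(\<lambda>x. emeasure (palm x i) A) \<in> borel_measurable borel" by simp
qed (simp_all add: prob_space_imp_subprob_space prob_space_palm)

text \<open>Both sides of the Campbell formula are integrals of
  \<open>1{x \<in> Y\<^sub>i} g((x,i),\<Psi>)\<close> over points and outcomes. The factor \<open>q i\<close> in the intensity measure
  cancels the normalisation of the conditional law.\<close>

lemma palm_distributions_palm: "palm_distributions M (coverage_measure Y) palm"
  unfolding palm_distributions_def
proof (intro conjI allI impI measurable_palm)
  interpret pair_sigma_finite lborel M ..
  fix g :: "('a \<times> 2) \<times> (2 \<Rightarrow> 'a measure) \<Rightarrow> ennreal"
  assume g [measurable]: "g \<in> borel_measurable ((borel \<Otimes>\<^sub>M count_space UNIV) \<Otimes>\<^sub>M bivariate_measures)"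
  have *: "(\<integral>\<^sup>+\<omega>. \<integral>\<^sup>+x. g ((x, i), coverage_measure Y \<omega>) \<partial>coverage_measure Y \<omega> i \<partial>M) =
      (\<integral>\<^sup>+x. \<integral>\<^sup>+\<psi>. g ((x, i), \<psi>) \<partial>palm x i \<partial>intensity_measure M (coverage_measure Y) i)" for i
  proof -
    have "(\<integral>\<^sup>+\<omega>. \<integral>\<^sup>+x. g ((x, i), coverage_measure Y \<omega>) \<partial>coverage_measure Y \<omega> i \<partial>M) =
        (\<integral>\<^sup>+\<omega>. \<integral>\<^sup>+x. indicator (Y \<omega> i) x * g ((x, i), coverage_measure Y \<omega>) \<partial>lborel \<partial>M)"
    proof (rule nn_integral_cong)
      fix \<omega> assume \<omega>: "\<omega> \<in> space M"
      note [measurable] = coverage_measure_space[OF \<omega>]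
      have "(\<lambda>x. g ((x, i), coverage_measure Y \<omega>)) \<in> borel_measurable borel" by measurable
      then show "(\<integral>\<^sup>+x. g ((x, i), coverage_measure Y \<omega>) \<partial>coverage_measure Y \<omega> i) =
          (\<integral>\<^sup>+x. indicator (Y \<omega> i) x * g ((x, i), coverage_measure Y \<omega>) \<partial>lborel)"
        by (rule nn_integral_coverage_measure[OF \<omega>])
    qed
    also have "\<dots> = (\<integral>\<^sup>+x. \<integral>\<^sup>+\<omega>. indicator (Y \<omega> i) x * g ((x, i), coverage_measure Y \<omega>) \<partial>M \<partial>lborel)"
      by (rule Fubini') measurable
    also have "\<dots> = (\<integral>\<^sup>+x. ennreal (q i) * (\<integral>\<^sup>+\<psi>. g ((x, i), \<psi>) \<partial>palm x i) \<partial>lborel)"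
    proof (rule nn_integral_cong)
      fix x :: 'a
      have cancel: "ennreal (q i) * (I / ennreal (q i)) = I" for I
      proof -
        have "I * ennreal (q i) / ennreal (q i) = I"
          by (rule mult_divide_eq_ennreal) (use q_pos[of i] in auto)
        then show ?thesis by (simp only: ennreal_times_divide mult.commute[of I])
      qed
      have "(\<lambda>\<psi>. g ((x, i), \<psi>)) \<in> borel_measurable bivariate_measures" by measurable
      then show "(\<integral>\<^sup>+\<omega>. indicator (Y \<omega> i) x * g ((x, i), coverage_measure Y \<omega>) \<partial>M) =
          ennreal (q i) * (\<integral>\<^sup>+\<psi>. g ((x, i), \<psi>) \<partial>palm x i)"
        by (simp add: nn_integral_palm cancel mult.commute)
    qed
    also have "\<dots> = (\<integral>\<^sup>+x. \<integral>\<^sup>+\<psi>. g ((x, i), \<psi>) \<partial>palm x i \<partial>density lborel (\<lambda>_. ennreal (q i)))"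
    proof (subst nn_integral_density)
      have [measurable]: "(\<lambda>x. palm x i) \<in> borel \<rightarrow>\<^sub>M subprob_algebra bivariate_measures"
        by (rule measurable_prob_algebraD[OF measurable_palm])
      have "(\<lambda>x. \<integral>\<^sup>+\<psi>. g ((x, i), \<psi>) \<partial>palm x i) \<in> borel_measurable borel" 
        by (rule nn_integral_measurable_subprob_algebra2[where N = bivariate_measures]) measurable
      then show "(\<lambda>x. \<integral>\<^sup>+\<psi>. g ((x, i), \<psi>) \<partial>palm x i) \<in> borel_measurable lborel" by simp
    qed auto
    finally show ?thesis by (simp add: intensity_measure_coverage)
  qed
  have "(\<lambda>\<omega>. \<integral>\<^sup>+x. g ((x, i), coverage_measure Y \<omega>) \<partial>coverage_measure Y \<omega> i) \<in> borel_measurable M" for i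
  proof (subst measurable_cong)
    show "(\<integral>\<^sup>+x. g ((x, i), coverage_measure Y \<omega>) \<partial>coverage_measure Y \<omega> i) =
          (\<integral>\<^sup>+x. indicator (Y \<omega> i) x * g ((x, i), coverage_measure Y \<omega>) \<partial>lborel)"
      if \<omega>: "\<omega> \<in> space M" for \<omega>
    proof -
      note [measurable] = coverage_measure_space[OF \<omega>]
      have "(\<lambda>x. g ((x, i), coverage_measure Y \<omega>)) \<in> borel_measurable borel" by measurable
      then show ?thesis by (rule nn_integral_coverage_measure[OF \<omega>])
    qed
  qed measurable
  then show "(\<integral>\<^sup>+\<omega>. (\<Sum>i\<in>UNIV. \<integral>\<^sup>+x. g ((x, i), coverage_measure Y \<omega>) \<partial>coverage_measure Y \<omega> i) \<partial>M) =
      (\<Sum>i\<in>UNIV. \<integral>\<^sup>+x. (\<integral>\<^sup>+\<psi>. g ((x, i), \<psi>) \<partial>palm x i) \<partial>intensity_measure M (coverage_measure Y) i)"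
    by (simp add: nn_integral_sum *)
qed

lemma integral_palm_void_weight:
  "(\<integral>\<psi>. void_weight c t a \<psi> \<partial>palm x i) =
     (\<integral>\<omega>. indicator (Y \<omega> i) x * void_weight c t a (coverage_measure Y \<omega>) \<partial>M) / q i"
proof -
  have [measurable]: "(\<lambda>\<psi>. void_weight c t a \<psi>) \<in> borel_measurable bivariate_measures" by measurable
  have "ennreal (\<integral>\<psi>. void_weight c t a \<psi> \<partial>palm x i) = (\<integral>\<^sup>+\<psi>. void_weight c t a \<psi> \<partial>palm x i)"
  proof -
    interpret P: prob_space "palm x i" by (rule prob_space_palm)
    show ?thesis
      by (intro nn_integral_eq_integral[symmetric] P.integrable_const_bound[where B = 1]) auto
  qed
  also have "\<dots> = (\<integral>\<^sup>+\<omega>. ennreal (void_weight c t a (coverage_measure Y \<omega>)) * indicator (Y \<omega> i) x \<partial>M) /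
      ennreal (q i)"
    by (rule nn_integral_palm) measurable
  also have "(\<integral>\<^sup>+\<omega>. ennreal (void_weight c t a (coverage_measure Y \<omega>)) * indicator (Y \<omega> i) x \<partial>M) =
      (\<integral>\<^sup>+\<omega>. ennreal (indicator (Y \<omega> i) x * void_weight c t a (coverage_measure Y \<omega>)) \<partial>M)"
    by (intro nn_integral_cong) (auto simp: indicator_def)
  also have "\<dots> = ennreal (\<integral>\<omega>. indicator (Y \<omega> i) x * void_weight c t a (coverage_measure Y \<omega>) \<partial>M)"
    by (intro nn_integral_eq_integral integrable_const_bound[where B = 1])
       (auto simp: indicator_def)
  also have "\<dots> / ennreal (q i) =
      ennreal ((\<integral>\<omega>. indicator (Y \<omega> i) x * void_weight c t a (coverage_measure Y \<omega>) \<partial>M) / q i)"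
    using q_pos by (intro divide_ennreal Bochner_Integration.integral_nonneg) auto
  finally show ?thesis
    using q_pos[of i] by (subst (asm) ennreal_inj) (auto intro!: divide_nonneg_nonneg Bochner_Integration.integral_nonneg less_imp_le)
qed

text \<open>The right-hand side does not involve \<open>P\<close>. So if the Palm expectations are almost
  everywhere constant, then the constant is the same for all versions \<open>P\<close> of the Palm
  distributions.\<close>

lemma palm_laplace_unique:
  assumes P: "palm_distributions M (coverage_measure Y) P"
    and \<kappa>: "AE a in lborel. (\<integral>\<psi>. void_weight c t a \<psi> \<partial>P a 1) = \<kappa>"
  shows "ennreal (q 1) * (ennreal \<kappa> * emeasure lborel (ball 0 1 :: 'a set)) =
    (\<integral>\<^sup>+\<omega>. \<integral>\<^sup>+x. ennreal (void_weight c t x (coverage_measure Y \<omega>)) * indicator (ball 0 1) x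
       \<partial>coverage_measure Y \<omega> 1 \<partial>M)"
proof -
  \<comment> \<open>Campbell's formula is applied to the weight, restricted to label 1 and to a ball of finite volume.\<close>
  define g :: "('a \<times> 2) \<times> (2 \<Rightarrow> 'a measure) \<Rightarrow> ennreal" where
    "g z = ennreal (void_weight c t (fst (fst z)) (snd z)) * indicator (ball 0 1) (fst (fst z)) *
       indicator {1} (snd (fst z))" for z
  have [measurable]: "g \<in> borel_measurable ((borel \<Otimes>\<^sub>M count_space UNIV) \<Otimes>\<^sub>M bivariate_measures)"
  proof -
    let ?K = "(borel \<Otimes>\<^sub>M count_space UNIV) \<Otimes>\<^sub>M bivariate_measures
      :: (('a \<times> 2) \<times> (2 \<Rightarrow> 'a measure)) measure"
    have [measurable]: "(\<lambda>z. indicator (ball 0 1) (fst (fst z)) :: ennreal) \<in> borel_measurable ?K"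
      by (rule measurable_compose[of "\<lambda>z. fst (fst z)" _ borel])
         (auto intro!: borel_measurable_indicator)
    have [measurable]: "(\<lambda>z. indicator {1} (snd (fst z)) :: ennreal) \<in> borel_measurable ?K"
      by (rule measurable_compose[of "\<lambda>z. snd (fst z)" _ "count_space UNIV"]) auto
    show ?thesis unfolding g_def by measurable
  qed
  have Pm: "(\<lambda>x. P x i) \<in> borel \<rightarrow>\<^sub>M prob_algebra bivariate_measures" for i
    using P by (simp add: palm_distributions_def)
  have inner: "(\<integral>\<^sup>+\<psi>. g ((x, 1), \<psi>) \<partial>P x 1) =
      ennreal (\<integral>\<psi>. void_weight c t x \<psi> \<partial>P x 1) * indicator (ball 0 1) x" for x
  proof -
    have Px: "prob_space (P x 1)" "sets (P x 1) = sets bivariate_measures"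
      using measurable_space[OF Pm, of x 1] by (simp_all add: space_prob_algebra)
    interpret Px: prob_space "P x 1" by fact
    have [measurable]: "(\<lambda>\<psi>. void_weight c t x \<psi>) \<in> borel_measurable (P x 1)"
      unfolding measurable_cong_sets[OF Px(2) refl] by measurable
    have "(\<integral>\<^sup>+\<psi>. g ((x, 1), \<psi>) \<partial>P x 1) = (\<integral>\<^sup>+\<psi>. ennreal (void_weight c t x \<psi>) \<partial>P x 1) * indicator (ball 0 1) x"
      by (simp add: g_def nn_integral_multc)
    also have "(\<integral>\<^sup>+\<psi>. ennreal (void_weight c t x \<psi>) \<partial>P x 1) = ennreal (\<integral>\<psi>. void_weight c t x \<psi> \<partial>P x 1)"
      by (intro nn_integral_eq_integral Px.integrable_const_bound[where B = 1]) auto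
    finally show ?thesis .
  qed
  have "(\<integral>\<^sup>+\<omega>. \<integral>\<^sup>+x. ennreal (void_weight c t x (coverage_measure Y \<omega>)) * indicator (ball 0 1) x
       \<partial>coverage_measure Y \<omega> 1 \<partial>M) =
      (\<integral>\<^sup>+\<omega>. (\<Sum>i\<in>UNIV. \<integral>\<^sup>+x. g ((x, i), coverage_measure Y \<omega>) \<partial>coverage_measure Y \<omega> i) \<partial>M)"
    by (simp add: sum_2 g_def)
  also have "\<dots> = (\<Sum>i\<in>UNIV. \<integral>\<^sup>+x. (\<integral>\<^sup>+\<psi>. g ((x, i), \<psi>) \<partial>P x i) \<partial>intensity_measure M (coverage_measure Y) i)"
    using P by (simp add: palm_distributions_def)
  also have "\<dots> = (\<integral>\<^sup>+x. (\<integral>\<^sup>+\<psi>. g ((x, 1), \<psi>) \<partial>P x 1) \<partial>density lborel (\<lambda>_. ennreal (q 1)))"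
    by (simp add: sum_2 intensity_measure_coverage) (simp add: g_def)
  also have "\<dots> = (\<integral>\<^sup>+x. ennreal (q 1) * (\<integral>\<^sup>+\<psi>. g ((x, 1), \<psi>) \<partial>P x 1) \<partial>lborel)"
  proof (rule nn_integral_density)
    have [measurable]: "(\<lambda>x. P x 1) \<in> borel \<rightarrow>\<^sub>M subprob_algebra bivariate_measures"
      by (rule measurable_prob_algebraD[OF Pm])
    have "(\<lambda>x. \<integral>\<^sup>+\<psi>. g ((x, 1), \<psi>) \<partial>P x 1) \<in> borel_measurable borel"
      by (rule nn_integral_measurable_subprob_algebra2[where N = bivariate_measures]) measurable
    then show "(\<lambda>x. \<integral>\<^sup>+\<psi>. g ((x, 1), \<psi>) \<partial>P x 1) \<in> borel_measurable lborel" by simp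
  qed simp
  also have "\<dots> = (\<integral>\<^sup>+x. ennreal (q 1) * (ennreal \<kappa> * indicator (ball 0 1) x) \<partial>(lborel :: 'a measure))"
    by (rule nn_integral_cong_AE) (use \<kappa> in \<open>auto simp: inner\<close>)
  also have "\<dots> = ennreal (q 1) * (ennreal \<kappa> * emeasure lborel (ball 0 1 :: 'a set))"
    unfolding mult.assoc[symmetric] by (rule nn_integral_cmult_indicator) simp
  finally show ?thesis by simp
qed

text \<open>The denominator of the cross J-function does not vanish, since balls have finite mass.\<close>

lemma expectation_void_weight_pos: "0 < expectation (\<lambda>\<omega>. void_weight c t a (coverage_measure Y \<omega>))"
proof -
  have [measurable]: "(\<lambda>\<omega>. void_weight c t a (coverage_measure Y \<omega>)) \<in> borel_measurable M" by measurable
  have int: "integrable M (\<lambda>\<omega>. void_weight c t a (coverage_measure Y \<omega>))"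
    by (intro integrable_const_bound[where B = 1]) auto
  have "expectation (\<lambda>\<omega>. void_weight c t a (coverage_measure Y \<omega>)) \<noteq> 0"
  proof
    assume "expectation (\<lambda>\<omega>. void_weight c t a (coverage_measure Y \<omega>)) = 0"
    then have "AE \<omega> in M. void_weight c t a (coverage_measure Y \<omega>) = 0"
      by (subst (asm) integral_nonneg_eq_0_iff_AE[OF int]) auto
    moreover have "AE \<omega> in M. 0 < void_weight c t a (coverage_measure Y \<omega>)"
      by (intro AE_I2 void_weight_pos coverage_measure_space)
    ultimately have "AE \<omega> in M. False" by eventually_elim simp
    then show False by simp
  qed
  moreover have "0 \<le> expectation (\<lambda>\<omega>. void_weight c t a (coverage_measure Y \<omega>))"
    by (intro Bochner_Integration.integral_nonneg) auto
  ultimately show ?thesis by linarith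
qed

text \<open>Existence of the value comes from the conditional laws and uniqueness from the Campbell
  formula.\<close>

lemma cross_J_coverage_measure:
  assumes L: "\<And>a. expectation (\<lambda>\<omega>. void_weight (1 / q 2) t a (coverage_measure Y \<omega>)) = L"
    and L1: "\<And>a. expectation (\<lambda>\<omega>. indicator (Y \<omega> 1) a * void_weight (1 / q 2) t a (coverage_measure Y \<omega>)) = L1"
  shows "cross_J M (coverage_measure Y) (coverage_prob M Y) t = L1 / (q 1 * L)"
proof -
  let ?p = "coverage_prob M Y" and ?\<Psi> = "coverage_measure Y" and ?c = "1 / q 2"
  have L_pos: "0 < L" using expectation_void_weight_pos[of ?c t 0] by (simp add: L)
  have den: "laplace M ?\<Psi> (J_test ?p t a) = L" for a
    using laplace_J_test[where p = ?p and q = q, OF coverage_prob_single measurable_coverage_measure,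
        of t a] L by simp
  have num: "laplace (P a 1) (\<lambda>\<psi>. \<psi>) (J_test ?p t a) = (\<integral>\<psi>. void_weight ?c t a \<psi> \<partial>P a 1)"
    if P: "palm_distributions M ?\<Psi> P" for P a
  proof -
    have "P a 1 \<in> space (prob_algebra bivariate_measures)"
      using P by (intro measurable_space[of "\<lambda>x. P x 1" borel]) (auto simp: palm_distributions_def)
    then have "(\<lambda>\<psi>. \<psi>) \<in> P a 1 \<rightarrow>\<^sub>M bivariate_measures"
      by (intro measurable_ident_sets) (simp add: space_prob_algebra)
    from laplace_J_test[where p = ?p and q = q, OF coverage_prob_single this] show ?thesis .
  qed
  have palm_num: "(\<integral>\<psi>. void_weight ?c t a \<psi> \<partial>palm a 1) = L1 / q 1" for a
    by (simp add: integral_palm_void_weight L1)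
  show ?thesis
    unfolding cross_J_def
  proof (rule the_equality)
    show "\<exists>P. palm_distributions M ?\<Psi> P \<and>
      (AE a in lborel. laplace (P a 1) (\<lambda>\<psi>. \<psi>) (J_test ?p t a) / laplace M ?\<Psi> (J_test ?p t a) = L1 / (q 1 * L))"
      using num[OF palm_distributions_palm] palm_distributions_palm
      by (intro exI[of _ palm]) (simp add: den palm_num)
  next
    fix J assume "\<exists>P. palm_distributions M ?\<Psi> P \<and>
      (AE a in lborel. laplace (P a 1) (\<lambda>\<psi>. \<psi>) (J_test ?p t a) / laplace M ?\<Psi> (J_test ?p t a) = J)"
    then obtain P where P: "palm_distributions M ?\<Psi> P"
      and AE: "AE a in lborel. (\<integral>\<psi>. void_weight ?c t a \<psi> \<partial>P a 1) / L = J"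
      using num den by auto
    from AE have AE': "AE a in lborel. (\<integral>\<psi>. void_weight ?c t a \<psi> \<partial>P a 1) = J * L"
      using L_pos by (auto simp: field_simps)
    \<comment> \<open>Equality of constants will be read off from extended non-negative reals, which would hide a negative one.\<close>
    have J_nonneg: "0 \<le> J * L"
    proof (rule ccontr)
      assume neg: "\<not> 0 \<le> J * L"
      have "(\<integral>\<psi>. void_weight ?c t a \<psi> \<partial>P a 1) \<noteq> J * L" for a
      proof -
        have "0 \<le> (\<integral>\<psi>. void_weight ?c t a \<psi> \<partial>P a 1)"
          by (intro Bochner_Integration.integral_nonneg) simp
        then show ?thesis using neg by linarith
      qed
      then have "AE a in (lborel :: 'a measure). False" using AE' by simp
      then show False 
        using AE_iff_measurable[of UNIV "lborel :: 'a measure" "\<lambda>_. False"] by simp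
    qed
    have "0 \<le> L1" unfolding L1[of 0, symmetric] by (intro Bochner_Integration.integral_nonneg) auto
    then have "0 \<le> L1 / q 1" using q_pos[of 1] by simp
    have "ennreal (q 1) * (ennreal (J * L) * emeasure lborel (ball 0 1 :: 'a set)) =
        ennreal (q 1) * (ennreal (L1 / q 1) * emeasure lborel (ball 0 1 :: 'a set))"
      unfolding palm_laplace_unique[OF P AE']
      by (rule palm_laplace_unique[OF palm_distributions_palm, symmetric]) (simp add: palm_num)
    moreover have "0 < emeasure lborel (ball 0 1 :: 'a set)"
      by (intro emeasure_lborel_open_pos) auto
    moreover have "emeasure lborel (ball 0 1 :: 'a set) < top"
      using emeasure_lborel_ball_finite[of "0 :: 'a" 1] by simp
    ultimately have "ennreal (J * L) = ennreal (L1 / q 1)"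
      using q_pos[of 1]
      by (auto simp: ennreal_mult_cancel_left mult.commute[of _ "emeasure lborel (ball 0 1 :: 'a set)"])
    then have "J * L = L1 / q 1" using J_nonneg \<open>0 \<le> L1 / q 1\<close> by simp
    then show "J = L1 / (q 1 * L)" using L_pos q_pos[of 1] by (simp add: field_simps)
  qed
qed

end

section \<open>Cumulant densities\<close>

text \<open>The cumulant density of a list depends only on the values of \<open>p\<close> on its
  sublists.\<close>

lemma cumulant_map:
  assumes "\<And>zs. p (map f zs) = p zs"
  shows "cumulant p (map f zs) = cumulant p zs"
proof (induction "length zs" arbitrary: zs rule: less_induct)
  case less
  have single: "p [f z] = p [z]" for z using assms[of "[z]"] by simp
  have "(\<Sum>P\<in>{P. partition_on {..<length zs} P \<and> P \<noteq> {{..<length zs}}}.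
        \<Prod>D\<in>P. cumulant p (nths (map f zs) D)) =
      (\<Sum>P\<in>{P. partition_on {..<length zs} P \<and> P \<noteq> {{..<length zs}}}.
        \<Prod>D\<in>P. cumulant p (nths zs D))"
    by (intro sum.cong prod.cong refl) (auto simp: nths_map intro!: less nths_partition_shorter)
  then show ?case
    by (subst (1 2) cumulant.simps) (simp add: assms single o_def)
qed

lemma proper_partitions_of_pair:
  "{P. partition_on {..<2::nat} P \<and> P \<noteq> {{..<2}}} = {{{0}, {1}}}"
proof (intro equalityI subsetI)
  fix P assume "P \<in> {{{0}, {1::nat}}}"
  then show "P \<in> {P. partition_on {..<2::nat} P \<and> P \<noteq> {{..<2}}}"
    by (auto simp: partition_on_def disjoint_def)
next
  fix P assume "P \<in> {P. partition_on {..<2::nat} P \<and> P \<noteq> {{..<2}}}"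
  then have part: "partition_on {..<2} P" and ne: "P \<noteq> {{..<2}}" by auto
  have blocks: "D = {0} \<or> D = {1}" if D: "D \<in> P" for D
  proof -
    have sub: "D \<subseteq> {..<2}" and "D \<noteq> {}"
      using partition_onD1[OF part] partition_onD3[OF part] D by auto
    \<comment> \<open>A dummy list of length 2 serves to show that a block of a proper partition is a proper subset.\<close>
    have "length (nths [(), ()] D) < 2"
      using nths_partition_shorter[of "[(), ()]" P D] part ne D by (simp add: numeral_2_eq_2)
    then have "D \<noteq> {0, 1}" by (auto simp: nths_Cons)
    moreover have "D \<subseteq> {0, 1}" using sub by auto
    ultimately show ?thesis using \<open>D \<noteq> {}\<close> by blast
  qed
  have "0 \<in> \<Union>P" "1 \<in> \<Union>P" using partition_onD1[OF part] by auto
  then have "{0} \<in> P" "{1} \<in> P" using blocks by fastforce+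
  then show "P \<in> {{{0}, {1}}}" using blocks by blast
qed

text \<open>The two-block partition contributes \<open>1\<close> to the expansion.\<close>

lemma cumulant_pair: "1 + cumulant p [y, z] = p [y, z] / (p [y] * p [z])"
proof -
  have "cumulant p (nths [y, z] {0}) = 1" "cumulant p (nths [y, z] {1}) = 1"
    by (simp_all add: cumulant.simps nths_Cons)
  then have "(\<Sum>P\<in>{P. partition_on {..<length [y, z]} P \<and> P \<noteq> {{..<length [y, z]}}}.
      \<Prod>D\<in>P. cumulant p (nths [y, z] D)) = 1"
    using proper_partitions_of_pair by (simp add: numeral_2_eq_2)
  then show ?thesis by (subst cumulant.simps) simp
qed

section \<open>Unions of grains as functionals of the germs\<close>

lemma emeasure_translate_cball:
  assumes "\<psi> \<in> space bivariate_measures"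
  shows "emeasure (translate a \<psi> i) (cball x t) = emeasure (\<psi> i) (cball (x - a) t)"
proof -
  have "(\<lambda>y. y + a) -` cball x t = cball (x - a) t"
    by (auto simp: dist_norm algebra_simps)
  then show ?thesis using emeasure_translate[OF assms, of "cball x t"] by simp
qed

lemma emeasure_translate_ball:
  assumes "\<psi> \<in> space bivariate_measures"
  shows "emeasure (translate a \<psi> i) (ball x t) = emeasure (\<psi> i) (ball (x - a) t)"
proof -
  have "(\<lambda>y. y + a) -` ball x t = ball (x - a) t"
    by (auto simp: dist_norm algebra_simps)
  then show ?thesis using emeasure_translate[OF assms, of "ball x t"] by simp
qed

text \<open>For an integer-valued \<open>m\<close> this is the union of the balls of radius
  \<open>r\<close> around the atoms. The definition in terms of masses is measurable in \<open>m\<close> on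
  all locally finite measures, so that stationarity can be applied to its functionals.\<close>

definition hit_set :: "real \<Rightarrow> 'a::euclidean_space measure \<Rightarrow> 'a set" where
  "hit_set r m = {x. emeasure m (cball x r) \<noteq> 0}"

lemma pred_hit_set [measurable (raw)]:
  assumes [measurable]: "f \<in> borel_measurable K" "\<Psi> \<in> K \<rightarrow>\<^sub>M bivariate_measures"
  shows "Measurable.pred K (\<lambda>z. f z \<in> hit_set r (\<Psi> z i))"
  unfolding hit_set_def mem_Collect_eq by measurable

lemma borel_hit_set: "\<psi> \<in> space bivariate_measures \<Longrightarrow> hit_set r (\<psi> i) \<in> sets borel"
  using pred_hit_set[of "\<lambda>x. x" borel "\<lambda>_. \<psi>" r i] by (simp add: pred_def)

lemma translate_hit_set:
  assumes "\<psi> \<in> space bivariate_measures"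
  shows "x \<in> hit_set r (translate a \<psi> i) \<longleftrightarrow> x - a \<in> hit_set r (\<psi> i)"
  by (simp add: hit_set_def emeasure_translate_cball[OF assms])

lemma measurable_hit_volume [measurable]:
  "(\<lambda>\<psi>. emeasure lborel (hit_set r (\<psi> i) \<inter> cball a t)) \<in> borel_measurable bivariate_measures"
proof -
  have "(\<lambda>\<psi>. \<integral>\<^sup>+x. indicator (hit_set r (\<psi> i)) x * indicator (cball a t) x \<partial>lborel)
      \<in> borel_measurable bivariate_measures"
    unfolding indicator_def mem_cball by measurable
  moreover have "emeasure lborel (hit_set r (\<psi> i) \<inter> cball a t) =
      (\<integral>\<^sup>+x. indicator (hit_set r (\<psi> i)) x * indicator (cball a t) x \<partial>lborel)"
    if "\<psi> \<in> space bivariate_measures" for \<psi> :: "2 \<Rightarrow> 'a measure"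
    using borel_hit_set[OF that, of r i] by (simp add: indicator_inter_arith[symmetric])
  ultimately show ?thesis by (subst measurable_cong) auto
qed

lemma translate_hit_volume:
  assumes \<psi>: "\<psi> \<in> space bivariate_measures"
  shows "emeasure lborel (hit_set r (translate a \<psi> i) \<inter> cball x t) =
    emeasure lborel (hit_set r (\<psi> i) \<inter> cball (x - a) t)"
proof -
  have "translate a \<psi> \<in> space bivariate_measures"
    using measurable_space[OF measurable_translate \<psi>] .
  then have "hit_set r (translate a \<psi> i) \<inter> cball x t \<in> sets borel"
    using borel_hit_set[of "translate a \<psi>" r i] by simp
  then have "emeasure lborel (hit_set r (translate a \<psi> i) \<inter> cball x t) =
      emeasure lborel ((\<lambda>y. a + 1 *\<^sub>R y) -` (hit_set r (translate a \<psi> i) \<inter> cball x t))"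
    using emeasure_lborel_affine_vimage[of _ 1 a] by simp
  also have "(\<lambda>y. a + 1 *\<^sub>R y) -` (hit_set r (translate a \<psi> i) \<inter> cball x t) =
      hit_set r (\<psi> i) \<inter> cball (x - a) t"
    by (auto simp: translate_hit_set[OF \<psi>] dist_norm algebra_simps)
  finally show ?thesis .
qed

text \<open>The weight \<open>void_weight\<close> of the coverage measure of a scaled germ-grain model,
  pulled back to the unscaled model as a functional of the point process; the factor \<open>c\<close>
  absorbs the change of volume.\<close>

definition scaled_void_weight :: "real \<Rightarrow> real \<Rightarrow> 'a::euclidean_space \<Rightarrow> real \<Rightarrow> (2 \<Rightarrow> 'a measure) \<Rightarrow> real" where
  "scaled_void_weight r t a c \<psi> = exp_neg (ennreal c * emeasure lborel (hit_set r (\<psi> 2) \<inter> cball a t))"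

lemma measurable_scaled_void_weight [measurable]:
  "scaled_void_weight r t a c \<in> borel_measurable bivariate_measures"
  unfolding scaled_void_weight_def[abs_def] by measurable

lemma scaled_void_weight_bounds [simp]:
  "0 \<le> scaled_void_weight r t a c \<psi>" "scaled_void_weight r t a c \<psi> \<le> 1"
  by (simp_all add: scaled_void_weight_def)

section \<open>Germ-grain models of a stationary point process\<close>

locale stationary_point_process = prob_space M for M :: "'w measure" +
  fixes N :: "'w \<Rightarrow> 2 \<Rightarrow> 'a::euclidean_space measure"
  assumes point_process: "point_process M N" and stationary: "stationary M N"
begin

lemma measurable_N [measurable]: "N \<in> M \<rightarrow>\<^sub>M bivariate_measures"
  using point_process by (simp add: point_process_def random_measure_def)

lemma N_space: "\<omega> \<in> space M \<Longrightarrow> N \<omega> \<in> space bivariate_measures"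
  using measurable_space[OF measurable_N] .

lemma integer_valued_N: "\<omega> \<in> space M \<Longrightarrow> integer_valued (N \<omega> i)"
  using N_space[of \<omega>] point_process
  by (auto simp: integer_valued_def space_bivariate_measures point_process_def)

lemma germ_grain_eq_hit_set: "\<omega> \<in> space M \<Longrightarrow> germ_grain r N \<omega> i = hit_set r (N \<omega> i)"
  using emeasure_cball_nonzero_iff[OF integer_valued_N, of \<omega> i _ r]
  by (auto simp: germ_grain_def hit_set_def dist_commute)

lemma translation_invariant_expectation:
  assumes [measurable]: "h \<in> borel_measurable bivariate_measures"
  shows "expectation (\<lambda>\<omega>. h (translate a (N \<omega>))) = expectation (\<lambda>\<omega>. h (N \<omega>) :: real)"
  by (rule stationary_integral[OF stationary]) measurable

lemma translation_invariant_prob: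
  assumes [measurable]: "Measurable.pred bivariate_measures Q"
  shows "prob {\<omega> \<in> space M. Q (translate a (N \<omega>))} = prob {\<omega> \<in> space M. Q (N \<omega>)}"
proof -
  have "prob {\<omega> \<in> space M. Q (f \<omega>)} = expectation (\<lambda>\<omega>. indicator {\<psi>. Q \<psi>} (f \<omega>))"
    for f :: "'w \<Rightarrow> 2 \<Rightarrow> 'a measure"
  proof -
    have "prob {\<omega> \<in> space M. Q (f \<omega>)} = expectation (indicator {\<omega> \<in> space M. Q (f \<omega>)})"
      by (simp add: Int_absorb2)
    also have "\<dots> = expectation (\<lambda>\<omega>. indicator {\<psi>. Q \<psi>} (f \<omega>))"
      by (intro Bochner_Integration.integral_cong) (auto simp: indicator_def)
    finally show ?thesis .
  qed
  moreover have "(\<lambda>\<psi>. indicator {\<psi>. Q \<psi>} \<psi> :: real) \<in> borel_measurable bivariate_measures"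
    unfolding indicator_def mem_Collect_eq by measurable
  ultimately show ?thesis
    using translation_invariant_expectation[of "indicator {\<psi>. Q \<psi>}" a] by simp
qed

lemma prob_hit_set: "0 \<le> t \<Longrightarrow> prob {\<omega> \<in> space M. x \<in> hit_set t (N \<omega> i)} = empty_space M N i t"
proof -
  assume t: "0 \<le> t"
  have "prob {\<omega> \<in> space M. x \<in> hit_set t (N \<omega> i)} =
      prob {\<omega> \<in> space M. 0 \<in> hit_set t (translate (- x) (N \<omega>) i)}"
    by (intro arg_cong[where f = prob] Collect_cong conj_cong refl) (simp add: translate_hit_set N_space)
  also have "\<dots> = prob {\<omega> \<in> space M. 0 \<in> hit_set t (N \<omega> i)}"
    by (rule translation_invariant_prob) measurable
  also have "\<dots> = empty_space M N i t"
    unfolding empty_space_def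
    by (intro arg_cong[where f = prob] Collect_cong conj_cong refl)
       (simp add: set_dist_points_le_iff[OF integer_valued_N t] hit_set_def)
  finally show ?thesis .
qed

lemma joint_empty_space_eq:
  assumes "0 \<le> t1" "0 \<le> t2"
  shows "joint_empty_space M N t1 t2 x =
    prob {\<omega> \<in> space M. 0 \<in> hit_set t1 (N \<omega> 1) \<and> x \<in> hit_set t2 (N \<omega> 2)}"
  unfolding joint_empty_space_def
  by (intro arg_cong[where f = prob] Collect_cong conj_cong refl)
     (simp_all add: set_dist_points_le_iff integer_valued_N assms hit_set_def)

lemma coverage_prob_germ_grain:
  "coverage_prob M (germ_grain r N) zs = prob {\<omega> \<in> space M. \<forall>(x, i)\<in>set zs. x \<in> hit_set r (N \<omega> i)}"
  unfolding coverage_prob_def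
  by (intro arg_cong[where f = prob] Collect_cong conj_cong refl) (simp add: germ_grain_eq_hit_set)

text \<open>The coverage function is invariant everywhere, not only almost everywhere, because it is the
  version given by probabilities.\<close>

lemma coverage_prob_translate:
  "coverage_prob M (germ_grain r N) (map (\<lambda>(x, i). (x + a, i)) zs) = coverage_prob M (germ_grain r N) zs"
proof -
  have "coverage_prob M (germ_grain r N) (map (\<lambda>(x, i). (x + a, i)) zs) =
      prob {\<omega> \<in> space M. \<forall>z\<in>set zs. fst z \<in> hit_set r (translate (- a) (N \<omega>) (snd z))}"
    unfolding coverage_prob_germ_grain
    by (intro arg_cong[where f = prob] Collect_cong conj_cong refl)
       (auto simp: translate_hit_set N_space)
  also have "\<dots> = prob {\<omega> \<in> space M. \<forall>z\<in>set zs. fst z \<in> hit_set r (N \<omega> (snd z))}"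
    by (rule translation_invariant_prob) measurable
  also have "\<dots> = coverage_prob M (germ_grain r N) zs"
    unfolding coverage_prob_germ_grain by (simp add: case_prod_beta)
  finally show ?thesis .
qed

lemma scaled_germ_grain_mem:
  assumes "\<omega> \<in> space M" "s \<noteq> 0"
  shows "x \<in> scale_set s (germ_grain r N) \<omega> i \<longleftrightarrow> x /\<^sub>R s \<in> hit_set r (N \<omega> i)"
proof
  assume "x \<in> scale_set s (germ_grain r N) \<omega> i"
  then show "x /\<^sub>R s \<in> hit_set r (N \<omega> i)"
    using assms by (auto simp: scale_set_def germ_grain_eq_hit_set)
next
  assume "x /\<^sub>R s \<in> hit_set r (N \<omega> i)"
  then have "s *\<^sub>R (x /\<^sub>R s) \<in> scale_set s (germ_grain r N) \<omega> i"
    unfolding scale_set_def germ_grain_eq_hit_set[OF assms(1)] by blast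
  then show "x \<in> scale_set s (germ_grain r N) \<omega> i" using assms(2) by simp
qed

lemma homogeneous_scaled_germ_grain:
  assumes "0 \<le> r" "s \<noteq> 0" "\<And>i. 0 < empty_space M N i r"
  shows "homogeneous_random_set M (scale_set s (germ_grain r N)) (\<lambda>i. empty_space M N i r)"
proof
  fix i x
  have "Measurable.pred (borel \<Otimes>\<^sub>M M) (\<lambda>z. fst z /\<^sub>R s \<in> hit_set r (N (snd z) i))" by measurable
  then show "Measurable.pred (borel \<Otimes>\<^sub>M M) (\<lambda>(x, \<omega>). x \<in> scale_set s (germ_grain r N) \<omega> i)"
    by (subst measurable_cong[where g = "\<lambda>z. fst z /\<^sub>R s \<in> hit_set r (N (snd z) i)"])
       (auto simp: space_pair_measure scaled_germ_grain_mem[OF _ assms(2)])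
  have "prob {\<omega> \<in> space M. x \<in> scale_set s (germ_grain r N) \<omega> i} =
      prob {\<omega> \<in> space M. x /\<^sub>R s \<in> hit_set r (N \<omega> i)}"
    by (intro arg_cong[where f = prob] Collect_cong conj_cong refl) (simp add: scaled_germ_grain_mem assms(2))
  then show "prob {\<omega> \<in> space M. x \<in> scale_set s (germ_grain r N) \<omega> i} = empty_space M N i r"
    by (simp add: prob_hit_set assms(1))
qed (rule assms(3))

lemma emeasure_scaled_coverage:
  assumes "\<omega> \<in> space M" "0 < s" "random_set M (scale_set s (germ_grain r N))"
  shows "emeasure (coverage_measure (scale_set s (germ_grain r N)) \<omega> i) (cball a (s * t)) =
    ennreal (s ^ DIM('a)) * emeasure lborel (hit_set r (N \<omega> i) \<inter> cball (a /\<^sub>R s) t)"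
proof -
  let ?Y = "scale_set s (germ_grain r N)"
  interpret random_set M ?Y by fact
  have "emeasure (coverage_measure ?Y \<omega> i) (cball a (s * t)) = emeasure lborel (?Y \<omega> i \<inter> cball a (s * t))"
    using assms(1) by (simp add: emeasure_coverage_measure_Int)
  also have "\<dots> = ennreal (\<bar>s\<bar> ^ DIM('a)) * emeasure lborel ((\<lambda>x. 0 + s *\<^sub>R x) -` (?Y \<omega> i \<inter> cball a (s * t)))"
    using assms(2) borel_section[OF assms(1), of i] by (intro emeasure_lborel_affine_vimage) auto
  also have "(\<lambda>x. 0 + s *\<^sub>R x) -` (?Y \<omega> i \<inter> cball a (s * t)) = hit_set r (N \<omega> i) \<inter> cball (a /\<^sub>R s) t"
  proof -
    have "dist a (s *\<^sub>R x) = s * dist (a /\<^sub>R s) x" for x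
    proof -
      have "a - s *\<^sub>R x = s *\<^sub>R (a /\<^sub>R s - x)" using assms(2) by (simp add: scaleR_diff_right)
      then show ?thesis using assms(2) by (simp only: dist_norm norm_scaleR)
    qed
    then show ?thesis
      using assms(2) by (auto simp: scaled_germ_grain_mem[OF assms(1)])
  qed
  finally show ?thesis using assms(2) by simp
qed

lemma expectation_scaled_void_weight:
  "expectation (\<lambda>\<omega>. scaled_void_weight r t b c (N \<omega>)) = expectation (\<lambda>\<omega>. scaled_void_weight r t 0 c (N \<omega>))"
proof -
  have "expectation (\<lambda>\<omega>. scaled_void_weight r t b c (N \<omega>)) =
      expectation (\<lambda>\<omega>. scaled_void_weight r t 0 c (translate (- b) (N \<omega>)))"
    by (intro Bochner_Integration.integral_cong)
       (simp_all add: scaled_void_weight_def translate_hit_volume N_space)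
  also have "\<dots> = expectation (\<lambda>\<omega>. scaled_void_weight r t 0 c (N \<omega>))"
    by (rule translation_invariant_expectation) measurable
  finally show ?thesis .
qed

lemma expectation_hit_scaled_void_weight:
  "expectation (\<lambda>\<omega>. indicator (hit_set r (N \<omega> 1)) b * scaled_void_weight r t b c (N \<omega>)) =
   expectation (\<lambda>\<omega>. indicator (hit_set r (N \<omega> 1)) 0 * scaled_void_weight r t 0 c (N \<omega>))"
proof -
  have "expectation (\<lambda>\<omega>. indicator (hit_set r (N \<omega> 1)) b * scaled_void_weight r t b c (N \<omega>)) =
      expectation (\<lambda>\<omega>. indicator (hit_set r (translate (- b) (N \<omega>) 1)) 0 *
        scaled_void_weight r t 0 c (translate (- b) (N \<omega>)))"
    by (intro Bochner_Integration.integral_cong)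
       (simp_all add: scaled_void_weight_def translate_hit_volume N_space indicator_def translate_hit_set)
  also have "\<dots> = expectation (\<lambda>\<omega>. indicator (hit_set r (N \<omega> 1)) 0 * scaled_void_weight r t 0 c (N \<omega>))"
    by (rule translation_invariant_expectation[of
          "\<lambda>\<psi>. indicator (hit_set r (\<psi> 1)) 0 * scaled_void_weight r t 0 c \<psi>"])
       (unfold indicator_def, measurable)
  finally show ?thesis .
qed

text \<open>Scaling by \<open>s\<close> leaves the coverage probabilities unchanged and multiplies the
  volume of the covered part of the ball by \<open>s\<^sup>d\<close>; stationarity moves the centre of the
  ball to the origin.\<close>

lemma cross_J_scaled:
  assumes "0 \<le> r" "0 < s" "\<And>i. 0 < empty_space M N i r"
  defines "c \<equiv> 1 / empty_space M N 2 r * s ^ DIM('a)"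
  shows "cross_J M (coverage_measure (scale_set s (germ_grain r N)))
      (coverage_prob M (scale_set s (germ_grain r N))) (s * t) =
    expectation (\<lambda>\<omega>. indicator (hit_set r (N \<omega> 1)) 0 * scaled_void_weight r t 0 c (N \<omega>)) /
    (empty_space M N 1 r * expectation (\<lambda>\<omega>. scaled_void_weight r t 0 c (N \<omega>)))"
proof -
  let ?Y = "scale_set s (germ_grain r N)" and ?q = "\<lambda>i. empty_space M N i r"
  interpret homogeneous_random_set M ?Y ?q
    using assms by (intro homogeneous_scaled_germ_grain) auto
  have weight: "void_weight (1 / ?q 2) (s * t) a (coverage_measure ?Y \<omega>) =
      scaled_void_weight r t (a /\<^sub>R s) c (N \<omega>)" if "\<omega> \<in> space M" for a \<omega>
  proof -
    have "ennreal c = ennreal (1 / ?q 2) * ennreal (s ^ DIM('a))"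
      unfolding c_def using assms(2) assms(3)[of 2] by (intro ennreal_mult) auto
    then show ?thesis
      using that assms(2)
      by (simp only: void_weight_def scaled_void_weight_def mult.assoc
          emeasure_scaled_coverage[OF _ _ random_set_axioms])
  qed
  show ?thesis
  proof (rule cross_J_coverage_measure)
    fix a
    have "expectation (\<lambda>\<omega>. void_weight (1 / ?q 2) (s * t) a (coverage_measure ?Y \<omega>)) =
        expectation (\<lambda>\<omega>. scaled_void_weight r t (a /\<^sub>R s) c (N \<omega>))"
      by (intro Bochner_Integration.integral_cong) (simp_all add: weight)
    then show "expectation (\<lambda>\<omega>. void_weight (1 / ?q 2) (s * t) a (coverage_measure ?Y \<omega>)) =
        expectation (\<lambda>\<omega>. scaled_void_weight r t 0 c (N \<omega>))"
      using expectation_scaled_void_weight by (rule trans)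
    have "expectation (\<lambda>\<omega>. indicator (?Y \<omega> 1) a * void_weight (1 / ?q 2) (s * t) a (coverage_measure ?Y \<omega>)) =
        expectation (\<lambda>\<omega>. indicator (hit_set r (N \<omega> 1)) (a /\<^sub>R s) * scaled_void_weight r t (a /\<^sub>R s) c (N \<omega>))"
      using assms(2)
      by (intro Bochner_Integration.integral_cong) (simp_all add: weight indicator_def scaled_germ_grain_mem)
    then show "expectation (\<lambda>\<omega>. indicator (?Y \<omega> 1) a * void_weight (1 / ?q 2) (s * t) a (coverage_measure ?Y \<omega>)) =
        expectation (\<lambda>\<omega>. indicator (hit_set r (N \<omega> 1)) 0 * scaled_void_weight r t 0 c (N \<omega>))"
      using expectation_hit_scaled_void_weight by (rule trans)
  qed
qed

end

section \<open>The limit of the cross J-function under scaling\<close>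

context stationary_point_process
begin

text \<open>By stationarity the probability that \<open>N\<^sub>i\<close> has a point on the sphere around
  \<open>x\<close>, but none inside, does not depend on \<open>x\<close>. Integrated over all
  \<open>x\<close> it is the expected volume of a set contained in a countable union of spheres, which is
  \<open>0\<close>.\<close>

lemma AE_no_points_on_sphere:
  "AE \<omega> in M. emeasure (N \<omega> i) (cball 0 t) \<noteq> 0 \<longrightarrow> emeasure (N \<omega> i) (ball 0 t) \<noteq> 0"
proof -
  interpret pair_sigma_finite lborel M ..
  let ?Q = "\<lambda>x \<psi>. emeasure (\<psi> i) (cball x t) \<noteq> 0 \<and> emeasure (\<psi> i) (ball x t) = 0"
  let ?I = "\<lambda>x \<omega>. if ?Q x (N \<omega>) then 1 else 0 :: ennreal"
  have Qm [measurable]: "Measurable.pred bivariate_measures (?Q x)" for x :: 'a by measurable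
  have prob: "(\<integral>\<^sup>+\<omega>. ?I x \<omega> \<partial>M) = ennreal (prob {\<omega> \<in> space M. ?Q 0 (N \<omega>)})" for x
  proof -
    have "(\<integral>\<^sup>+\<omega>. ?I x \<omega> \<partial>M) = (\<integral>\<^sup>+\<omega>. indicator {\<omega> \<in> space M. ?Q x (N \<omega>)} \<omega> \<partial>M)"
      by (intro nn_integral_cong) (simp add: indicator_def)
    also have "\<dots> = ennreal (prob {\<omega> \<in> space M. ?Q x (N \<omega>)})"
      by (subst nn_integral_indicator) (auto simp: emeasure_eq_measure)
    also have "prob {\<omega> \<in> space M. ?Q x (N \<omega>)} = prob {\<omega> \<in> space M. ?Q 0 (translate (- x) (N \<omega>))}"
      by (intro arg_cong[where f = prob] Collect_cong conj_cong refl)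
         (simp_all add: emeasure_translate_cball emeasure_translate_ball N_space)
    also have "\<dots> = prob {\<omega> \<in> space M. ?Q 0 (N \<omega>)}"
      by (rule translation_invariant_prob) measurable
    finally show ?thesis .
  qed
  have null: "(\<integral>\<^sup>+x. ?I x \<omega> \<partial>lborel) = 0" if \<omega>: "\<omega> \<in> space M" for \<omega>
  proof -
    note m = integer_valued_N[OF \<omega>, of i]
    have "(\<Union>y\<in>points (N \<omega> i). sphere y t) \<in> null_sets lborel"
      by (intro null_sets_UN' countable_points m sphere_null_sets)
    then have "AE x in lborel. x \<notin> (\<Union>y\<in>points (N \<omega> i). sphere y t)" by (rule AE_not_in)
    then have "AE x in lborel. ?I x \<omega> = 0"
    proof eventually_elim
      case (elim x)
      have "\<not> ?Q x (N \<omega>)"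
      proof
        assume "?Q x (N \<omega>)"
        then obtain y where y: "y \<in> points (N \<omega> i)" "dist x y \<le> t" "\<not> dist x y < t"
          using emeasure_cball_nonzero_iff[OF m] emeasure_ball_nonzero_iff[OF m] by blast
        then have "x \<in> sphere y t" by (simp add: dist_commute)
        with elim y(1) show False by blast
      qed
      then show ?case by simp
    qed
    then have "(\<integral>\<^sup>+x. ?I x \<omega> \<partial>lborel) = (\<integral>\<^sup>+x. 0 \<partial>(lborel :: 'a measure))"
      by (rule nn_integral_cong_AE)
    then show ?thesis by simp
  qed
  \<comment> \<open>The whole space has infinite volume, so a vanishing product forces the probability to vanish.\<close>
  have "ennreal (prob {\<omega> \<in> space M. ?Q 0 (N \<omega>)}) * emeasure lborel (UNIV :: 'a set) =
      (\<integral>\<^sup>+x. \<integral>\<^sup>+\<omega>. ?I x \<omega> \<partial>M \<partial>lborel)"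
    by (simp only: prob) simp
  also have "\<dots> = (\<integral>\<^sup>+\<omega>. \<integral>\<^sup>+x. ?I x \<omega> \<partial>lborel \<partial>M)"
    by (rule Fubini'[symmetric]) measurable
  also have "\<dots> = (\<integral>\<^sup>+\<omega>. 0 \<partial>M)"
    by (intro nn_integral_cong null)
  finally have "prob {\<omega> \<in> space M. ?Q 0 (N \<omega>)} = 0"
    by (simp add: ennreal_mult_eq_top_iff)
  then have "AE \<omega> in M. \<not> ?Q 0 (N \<omega>)"
    by (subst AE_iff_measurable[of "{\<omega> \<in> space M. ?Q 0 (N \<omega>)}"]) (auto simp: emeasure_eq_measure)
  then show ?thesis by eventually_elim auto
qed

text \<open>A point at distance less than \<open>r + t\<close> from the origin has a grain whose interior
  meets the open ball of radius \<open>t\<close>, and a non-empty open set has positive volume.\<close>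

lemma hit_volume_positive:
  assumes \<omega>: "\<omega> \<in> space M" and r: "0 < r" and t: "0 < t"
    and hit: "emeasure (N \<omega> i) (ball 0 (r + t)) \<noteq> 0"
  shows "0 < emeasure lborel (hit_set r (N \<omega> i) \<inter> cball 0 t)"
proof -
  note m = integer_valued_N[OF \<omega>, of i]
  obtain y where y: "y \<in> points (N \<omega> i)" "norm y < r + t"
    using hit emeasure_ball_nonzero_iff[OF m] by auto
  \<comment> \<open>This point divides the segment from the origin to y in the ratio t : r.\<close>
  let ?z = "(t / (r + t)) *\<^sub>R y"
  have "norm ?z < t"
  proof -
    have "norm ?z = t * (norm y / (r + t))" using r t by simp
    also have "\<dots> < t * 1" using r t y(2) by (intro mult_strict_left_mono) auto
    finally show ?thesis by simp
  qed
  moreover have "dist y ?z < r"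
  proof -
    have "y - ?z = (r / (r + t)) *\<^sub>R y"
    proof -
      have "y - ?z = (1 - t / (r + t)) *\<^sub>R y" by (simp add: scaleR_diff_left)
      also have "1 - t / (r + t) = r / (r + t)" using r t by (simp add: field_simps)
      finally show ?thesis .
    qed
    then have "dist y ?z = r * (norm y / (r + t))" using r t by (simp add: dist_norm)
    also have "\<dots> < r * 1" using r t y(2) by (intro mult_strict_left_mono) auto
    finally show ?thesis by simp
  qed
  ultimately have "?z \<in> ball y r \<inter> ball 0 t" by simp
  then have "ball y r \<inter> ball 0 t \<noteq> {}" by blast
  then have "0 < emeasure lborel (ball y r \<inter> ball 0 t)"
    by (intro emeasure_lborel_open_pos) auto
  also have "\<dots> \<le> emeasure lborel (hit_set r (N \<omega> i) \<inter> cball 0 t)"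
  proof (rule emeasure_mono)
    show "ball y r \<inter> ball 0 t \<subseteq> hit_set r (N \<omega> i) \<inter> cball 0 t"
    proof
      fix x assume x: "x \<in> ball y r \<inter> ball 0 t"
      then have "dist x y \<le> r" by (simp add: dist_commute)
      then have "x \<in> hit_set r (N \<omega> i)"
        using emeasure_cball_nonzero_iff[OF m] y(1) by (auto simp: hit_set_def)
      then show "x \<in> hit_set r (N \<omega> i) \<inter> cball 0 t" using x by simp
    qed
    show "hit_set r (N \<omega> i) \<inter> cball 0 t \<in> sets lborel"
      using borel_hit_set[OF N_space[OF \<omega>]] by simp
  qed
  finally show ?thesis .
qed

lemma hit_set_cball_empty:
  assumes \<omega>: "\<omega> \<in> space M" and void: "emeasure (N \<omega> i) (cball 0 (r + t)) = 0"
  shows "hit_set r (N \<omega> i) \<inter> cball 0 t = {}"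
proof (rule ccontr)
  note m = integer_valued_N[OF \<omega>, of i]
  assume "hit_set r (N \<omega> i) \<inter> cball 0 t \<noteq> {}"
  then obtain x y where "y \<in> points (N \<omega> i)" and xy: "dist x y \<le> r" "dist 0 x \<le> t"
    unfolding hit_set_def using emeasure_cball_nonzero_iff[OF m] by force
  moreover have "dist 0 y \<le> r + t" using xy dist_triangle[of 0 y x] by linarith
  ultimately show False using void emeasure_cball_nonzero_iff[OF m] by blast
qed

text \<open>Almost surely the volume of the grains in \<open>B(0,t)\<close> vanishes exactly if
  \<open>N\<^sub>2\<close> has no point in \<open>B(0,r+t)\<close>.\<close>

lemma scaled_void_weight_limit:
  assumes r: "0 < r" and t: "0 < t" and c: "filterlim c at_top at_top"
  shows "AE \<omega> in M. ((\<lambda>s. scaled_void_weight r t 0 (c s) (N \<omega>)) \<longlongrightarrow>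
    indicator {\<omega>. 0 \<notin> hit_set (r + t) (N \<omega> 2)} \<omega>) (at_top :: real filter)"
  using AE_no_points_on_sphere[of 2 "r + t"] AE_space
proof eventually_elim
  case (elim \<omega>)
  let ?V = "emeasure lborel (hit_set r (N \<omega> 2) \<inter> cball 0 t)"
  show ?case
  proof (cases "0 \<in> hit_set (r + t) (N \<omega> 2)")
    case False
    then have "?V = 0"
      using hit_set_cball_empty[OF elim(2), of 2 r t] by (simp add: hit_set_def)
    then show ?thesis using False by (simp add: scaled_void_weight_def exp_neg_def)
  next
    case True
    then have "0 < ?V"
      using elim by (intro hit_volume_positive r t) (auto simp: hit_set_def)
    have "?V \<le> emeasure lborel (cball 0 t :: 'a set)" by (intro emeasure_mono) auto
    also have "\<dots> < \<infinity>" by (rule emeasure_lborel_cball_finite)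
    finally obtain v where v: "?V = ennreal v" "0 < v"
      using \<open>0 < ?V\<close> by (cases ?V) auto
    have "((\<lambda>s. exp (- (c s * v))) \<longlongrightarrow> 0) at_top"
      by (intro filterlim_compose[OF exp_at_bot] filterlim_compose[OF filterlim_uminus_at_bot_at_top]
          filterlim_at_top_mult_tendsto_pos[OF tendsto_const v(2)] c)
    moreover have "\<forall>\<^sub>F s in at_top. exp (- (c s * v)) = scaled_void_weight r t 0 (c s) (N \<omega>)"
      using c[unfolded filterlim_at_top, rule_format, of 0]
    proof eventually_elim
      case (elim s)
      then show ?case
        using v(2) by (simp add: scaled_void_weight_def v(1) ennreal_mult[symmetric] exp_neg_ennreal)
    qed
    ultimately have "((\<lambda>s. scaled_void_weight r t 0 (c s) (N \<omega>)) \<longlongrightarrow> 0) at_top"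
      by (rule Lim_transform_eventually)
    then show ?thesis using True by simp
  qed
qed

text \<open>Numerator and denominator of the cross J-function are the cases where \<open>Q\<close> says
  that the origin is covered by the first component and where \<open>Q\<close> is always true.\<close>

lemma expectation_scaled_void_weight_limit:
  assumes r: "0 < r" and t: "0 < t" and c: "filterlim c at_top at_top"
    and [measurable]: "Measurable.pred M Q"
  shows "((\<lambda>s. expectation (\<lambda>\<omega>. (if Q \<omega> then 1 else 0) * scaled_void_weight r t 0 (c s) (N \<omega>))) \<longlongrightarrow>
    prob {\<omega> \<in> space M. Q \<omega> \<and> 0 \<notin> hit_set (r + t) (N \<omega> 2)}) (at_top :: real filter)"
proof -
  let ?A = "{\<omega> \<in> space M. Q \<omega> \<and> 0 \<notin> hit_set (r + t) (N \<omega> 2)}"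
  have "((\<lambda>s. expectation (\<lambda>\<omega>. (if Q \<omega> then 1 else 0) * scaled_void_weight r t 0 (c s) (N \<omega>))) \<longlongrightarrow>
      expectation (indicator ?A)) at_top"
  proof (rule integral_dominated_convergence_at_top[where w = "\<lambda>_. 1"])
    show "indicator ?A \<in> borel_measurable M" by measurable
    show "(\<lambda>\<omega>. (if Q \<omega> then 1 else 0) * scaled_void_weight r t 0 (c s) (N \<omega>)) \<in> borel_measurable M" for s
      by measurable
    show "AE \<omega> in M. ((\<lambda>s. (if Q \<omega> then 1 else 0) * scaled_void_weight r t 0 (c s) (N \<omega>)) \<longlongrightarrow>
        indicator ?A \<omega>) at_top"
      using scaled_void_weight_limit[OF r t c] AE_space
    proof eventually_elim
      case (elim \<omega>)
      have "((\<lambda>s. (if Q \<omega> then 1 else 0) * scaled_void_weight r t 0 (c s) (N \<omega>)) \<longlongrightarrow>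
          (if Q \<omega> then 1 else 0) * indicator {\<omega>. 0 \<notin> hit_set (r + t) (N \<omega> 2)} \<omega>) at_top"
        by (intro tendsto_mult tendsto_const elim(1))
      also have "(if Q \<omega> then 1 else 0) * indicator {\<omega>. 0 \<notin> hit_set (r + t) (N \<omega> 2)} \<omega> =
          (indicator ?A \<omega> :: real)"
        using elim(2) by (auto simp: indicator_def)
      finally show ?case .
    qed
    show "\<forall>\<^sub>F s in at_top. AE \<omega> in M.
        norm ((if Q \<omega> then 1 else 0) * scaled_void_weight r t 0 (c s) (N \<omega>)) \<le> 1"
      by (intro always_eventually allI AE_I2) simp
  qed simp
  also have "expectation (indicator ?A) = prob ?A" by (simp add: Int_absorb2)
  finally show ?thesis .
qed

lemma cross_J_limit:
  assumes r: "0 < r" and t: "0 < t" and F: "\<And>i. 0 < empty_space M N i r"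
    and less: "empty_space M N 2 (r + t) < 1"
  shows "((\<lambda>s. cross_J M (coverage_measure (scale_set s (germ_grain r N)))
      (coverage_prob M (scale_set s (germ_grain r N))) (s * t)) \<longlongrightarrow>
    (empty_space M N 1 r - joint_empty_space M N r (r + t) 0) /
      (empty_space M N 1 r * (1 - empty_space M N 2 (r + t)))) at_top"
proof -
  let ?q = "\<lambda>i. empty_space M N i r"
  let ?c = "\<lambda>s. 1 / ?q 2 * s ^ DIM('a)"
  let ?E = "\<lambda>Q s. expectation (\<lambda>\<omega>. (if Q \<omega> then 1 else 0) * scaled_void_weight r t 0 (?c s) (N \<omega>))"
  let ?hit = "\<lambda>\<omega>. 0 \<in> hit_set r (N \<omega> 1)" and ?hit2 = "\<lambda>\<omega>. 0 \<in> hit_set (r + t) (N \<omega> 2)"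
  have c: "filterlim ?c at_top at_top"
    using F[of 2] by (intro filterlim_tendsto_pos_mult_at_top[OF tendsto_const] filterlim_pow_at_top
        filterlim_ident) auto
  have num: "prob {\<omega> \<in> space M. ?hit \<omega> \<and> \<not> ?hit2 \<omega>} = ?q 1 - joint_empty_space M N r (r + t) 0"
  proof -
    have "prob {\<omega> \<in> space M. ?hit \<omega> \<and> \<not> ?hit2 \<omega>} =
        prob ({\<omega> \<in> space M. ?hit \<omega>} - {\<omega> \<in> space M. ?hit \<omega> \<and> ?hit2 \<omega>})"
      by (intro arg_cong[where f = prob]) auto
    also have "\<dots> = prob {\<omega> \<in> space M. ?hit \<omega>} - prob {\<omega> \<in> space M. ?hit \<omega> \<and> ?hit2 \<omega>}"
      by (intro finite_measure_Diff) auto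
    finally show ?thesis using r t by (simp add: prob_hit_set joint_empty_space_eq)
  qed
  have den: "prob {\<omega> \<in> space M. True \<and> \<not> ?hit2 \<omega>} = 1 - empty_space M N 2 (r + t)"
    using r t prob_neg[of ?hit2] by (simp add: prob_hit_set)
  have "((\<lambda>s. ?E ?hit s / (?q 1 * ?E (\<lambda>_. True) s)) \<longlongrightarrow>
      (?q 1 - joint_empty_space M N r (r + t) 0) / (?q 1 * (1 - empty_space M N 2 (r + t)))) at_top"
    unfolding num[symmetric] den[symmetric]
  proof (intro tendsto_divide tendsto_mult tendsto_const expectation_scaled_void_weight_limit[OF r t c])
    show "?q 1 * prob {\<omega> \<in> space M. True \<and> \<not> ?hit2 \<omega>} \<noteq> 0"
      unfolding den using F[of 1] less by simp
  qed measurable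
  moreover have "\<forall>\<^sub>F s in at_top. ?E ?hit s / (?q 1 * ?E (\<lambda>_. True) s) =
      cross_J M (coverage_measure (scale_set s (germ_grain r N)))
        (coverage_prob M (scale_set s (germ_grain r N))) (s * t)"
    using eventually_gt_at_top[of 0]
  proof eventually_elim
    case (elim s)
    then show ?case
      using cross_J_scaled[of r s t] r F by (simp add: indicator_def of_bool_def)
  qed
  ultimately show ?thesis by (rule Lim_transform_eventually)
qed

lemma germ_grain_homogeneous:
  assumes "0 \<le> r" "\<And>i. 0 < empty_space M N i r"
  shows "homogeneous_random_set M (germ_grain r N) (\<lambda>i. empty_space M N i r)"
proof -
  have "scale_set 1 (germ_grain r N) = germ_grain r N" by (intro ext) (simp add: scale_set_def)
  then show ?thesis using homogeneous_scaled_germ_grain[of r 1] assms by simp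
qed

lemma coverage_reweighted_moment_stationary_germ_grain:
  assumes "0 \<le> r" and F: "\<And>i. 0 < empty_space M N i r"
  shows "coverage_reweighted_moment_stationary M (coverage_measure (germ_grain r N))
    (coverage_prob M (germ_grain r N))"
proof -
  let ?p = "coverage_prob M (germ_grain r N)"
  interpret homogeneous_random_set M "germ_grain r N" "\<lambda>i. empty_space M N i r"
    using assms by (rule germ_grain_homogeneous)
  have "0 < min (empty_space M N 1 r) (empty_space M N 2 r)" using F by simp
  also have "\<dots> \<le> (INF z. ?p [z])"
  proof (rule cINF_greatest)
    fix z :: "'a \<times> 2"
    obtain x i where z: "z = (x, i)" by (cases z)
    show "min (empty_space M N 1 r) (empty_space M N 2 r) \<le> ?p [z]"
      using exhaust_2[of i] by (auto simp: z coverage_prob_single)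
  qed simp
  finally have "0 < (INF z. ?p [z])" .
  moreover have "cumulant ?p (labelled k (\<lambda>j. x j + a) i) = cumulant ?p (labelled k x i)" for k x i a
  proof -
    have "labelled k (\<lambda>j. x j + a) i = map (\<lambda>(x, i). (x + a, i)) (labelled k x i)"
      by (simp add: labelled_def)
    then show ?thesis 
      using cumulant_map[where p = ?p and f = "\<lambda>(x, i). (x + a, i)", OF coverage_prob_translate]
      by simp
  qed
  ultimately show ?thesis
    unfolding coverage_reweighted_moment_stationary_def random_measure_def
    using measurable_coverage_measure moments_locally_finite_coverage coverage_functions_coverage_prob
    by simp
qed

lemma cross_K_germ_grain:
  assumes "0 \<le> r" and F: "\<And>i. 0 < empty_space M N i r"
  shows "cross_K (coverage_prob M (germ_grain r N)) t =
    1 / (empty_space M N 1 r * empty_space M N 2 r) * (LINT x:cball 0 t|lborel. joint_empty_space M N r r x)"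
proof -
  interpret homogeneous_random_set M "germ_grain r N" "\<lambda>i. empty_space M N i r"
    using assms by (rule germ_grain_homogeneous)
  have "1 + cumulant (coverage_prob M (germ_grain r N)) [(0, 1), (x, 2)] =
      1 / (empty_space M N 1 r * empty_space M N 2 r) * joint_empty_space M N r r x" for x
    unfolding cumulant_pair coverage_prob_single joint_empty_space_eq[OF assms(1) assms(1)]
    by (simp add: coverage_prob_germ_grain)
  then show ?thesis by (simp add: cross_K_def)
qed

end

theorem theorem7:
  fixes M :: "'w measure"
    and N :: "'w \<Rightarrow> 2 \<Rightarrow> 'a::euclidean_space measure"
    and r :: real
  assumes "prob_space M"
    and "point_process M N"
    and "stationary M N"
    and "0 < r"
    and "\<forall>i. 0 < empty_space M N i r"
  defines "X \<equiv> germ_grain r N"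
  shows "coverage_reweighted_moment_stationary M (coverage_measure X) (coverage_prob M X) \<and>
    (\<forall>t\<ge>0. cross_K (coverage_prob M X) t =
       1 / (empty_space M N 1 r * empty_space M N 2 r) *
         (LINT x:cball 0 t|lborel. joint_empty_space M N r r x)) \<and>
    (\<forall>t>0. 0 < empty_space M N 1 r \<longrightarrow> empty_space M N 2 (r + t) < 1 \<longrightarrow>
       ((\<lambda>s. cross_J M (coverage_measure (scale_set s X)) (coverage_prob M (scale_set s X)) (s * t))
          \<longlongrightarrow> (empty_space M N 1 r - joint_empty_space M N r (r + t) 0) /
               (empty_space M N 1 r * (1 - empty_space M N 2 (r + t)))) at_top)"
proof -
  interpret prob_space M by fact
  interpret stationary_point_process M N
    using assms by unfold_locales auto
  have r: "0 \<le> r" and F: "0 < empty_space M N i r" for i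
    using assms by auto
  show ?thesis
    unfolding X_def
    using coverage_reweighted_moment_stationary_germ_grain[OF r F] cross_K_germ_grain[OF r F]
      cross_J_limit[OF \<open>0 < r\<close> _ F]
    by blast
qed

end
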